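(* Suppose $n > 1$. Let $\varphi_1$ and $\varphi_2$ be nonconstant inner functions in $H^{\infty}(\mathbb{D}^n)$. Then the truncated Toeplitz operator $T^{\varphi_1}_{\varphi_2}$ on $\mathcal{Q}_{\varphi_1}$ is an isometry if and only if $\varphi_1$ and $\varphi_2$ are separated.
   Context: $\mathbb{D}^n$ is the open unit polydisc in $\mathbb{C}^n$ and $\mathbb{T}^n$ its distinguished boundary. $H^\infty(\mathbb{D}^n)$ is the algebra of bounded analytic functions on $\mathbb{D}^n$. $H^2(\mathbb{D}^n)$ is the Hardy space of analytic functions $f$ on $\mathbb{D}^n$ with $\|f\|^2 = \sup_{0 \le r < 1} \int_{\mathbb{T}^n} |f(rz_1,\ldots,rz_n)|^2\, dm(z) < \infty$, where $m$ is normalized Lebesgue measure on $\mathbb{T}^n$. A function $\varphi \in H^\infty(\mathbb{D}^n)$ is inner if its radial boundary values satisfy $|\varphi(z)| = 1$ for almost every $z \in \mathbb{T}^n$. For an inner function $\varphi$, the model space is $\mathcal{Q}_\varphi = H^2(\mathbb{D}^n) \ominus \varphi H^2(\mathbb{D}^n)$. For inner functions $\varphi_1, \varphi_2$, the truncated Toeplitz operator $T^{\varphi_1}_{\varphi_2} : \mathcal{Q}_{\varphi_1} \to \mathcal{Q}_{\varphi_1}$ is defined by $T^{\varphi_1}_{\varphi_2} f = P_{\mathcal{Q}_{\varphi_1}}(\varphi_2 f)$, where $P_{\mathcal{Q}_{\varphi_1}}$ is the orthogonal projection onto $\mathcal{Q}_{\varphi_1}$. Two functions on $\mathbb{D}^n$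 are separated if they do not depend on common variables, i.e. no coordinate $z_i$ is such that both functions depend on $z_i$. *)

theory Defs
  imports "HOL-Analysis.Analysis"
begin

definition polydisc :: "(complex ^ 'n) set" where
  "polydisc = {z. \<forall>i. norm (z $ i) < 1}"

definition circle_measure :: "complex measure" where
  "circle_measure = distr (uniform_measure lborel {0..2 * pi}) borel cis"

text \<open>The normalized Lebesgue measure of the torus, as a Borel measure on the whole of
  \<^typ>\<open>complex ^ 'n\<close> that is concentrated on the torus.\<close>

definition torus_measure :: "(complex ^ 'n) measure" where
  "torus_measure = distr (PiM UNIV (\<lambda>_. circle_measure)) borel vec_lambda"

text \<open>Complex differentiability: the real Frechet derivative exists and is complex linear.\<close>

definition analytic_on_polydisc :: "(complex ^ 'n \<Rightarrow> complex) \<Rightarrow> bool" where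
  "analytic_on_polydisc f \<longleftrightarrow>
     (\<forall>z\<in>polydisc. \<exists>f'. (f has_derivative f') (at z) \<and> (\<forall>c v. f' (c *s v) = c * f' v))"

definition H_infinity :: "(complex ^ 'n \<Rightarrow> complex) set" where
  "H_infinity = {f. analytic_on_polydisc f \<and> bounded (f ` polydisc)}"

definition square_mean :: "(complex ^ 'n \<Rightarrow> complex) \<Rightarrow> real \<Rightarrow> real" where
  "square_mean f r = (LINT z|torus_measure. (norm (f (r *\<^sub>R z)))\<^sup>2)"

text \<open>Elements of the Hardy space are functions on the polydisc only. Extending them by 0 makes
  equality of HOL functions coincide with equality on the polydisc, so that the orthogonal
  projection below is uniquely determined.\<close>

definition hardy2 :: "(complex ^ 'n \<Rightarrow> complex) set" where
  "hardy2 = {f. analytic_on_polydisc f \<and> (\<forall>z. z \<notin> polydisc \<longrightarrow> f z = 0) \<and>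
                bdd_above (square_mean f ` {0..<1})}"

definition hardy_norm :: "(complex ^ 'n \<Rightarrow> complex) \<Rightarrow> real" where
  "hardy_norm f = sqrt (SUP r\<in>{0..<1}. square_mean f r)"

text \<open>The inner product that induces \<^const>\<open>hardy_norm\<close>; \<^term>\<open>square_mean f r\<close> is
  nondecreasing in \<^term>\<open>r\<close>, so its supremum is its limit as \<^term>\<open>r\<close> tends to 1.\<close>

definition hardy_inner :: "(complex ^ 'n \<Rightarrow> complex) \<Rightarrow> (complex ^ 'n \<Rightarrow> complex) \<Rightarrow> complex" where
  "hardy_inner f g =
     Lim (at_left 1) (\<lambda>r::real. LINT z|torus_measure. f (r *\<^sub>R z) * cnj (g (r *\<^sub>R z)))"

definition inner_function :: "(complex ^ 'n \<Rightarrow> complex) \<Rightarrow> bool" where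
  "inner_function \<phi> \<longleftrightarrow> \<phi> \<in> H_infinity \<and>
     (AE z in torus_measure. \<exists>w. ((\<lambda>r::real. \<phi> (r *\<^sub>R z)) \<longlongrightarrow> w) (at_left 1) \<and> norm w = 1)"

definition model_space :: "(complex ^ 'n \<Rightarrow> complex) \<Rightarrow> (complex ^ 'n \<Rightarrow> complex) set" where
  "model_space \<phi> = {f \<in> hardy2. \<forall>h\<in>hardy2. hardy_inner f (\<lambda>z. \<phi> z * h z) = 0}"

definition hardy_proj ::
  "(complex ^ 'n \<Rightarrow> complex) set \<Rightarrow> (complex ^ 'n \<Rightarrow> complex) \<Rightarrow> complex ^ 'n \<Rightarrow> complex" where
  "hardy_proj S f = (THE g. g \<in> S \<and> (\<forall>h\<in>S. hardy_inner (\<lambda>z. f z - g z) h = 0))"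

definition truncated_toeplitz ::
  "(complex ^ 'n \<Rightarrow> complex) \<Rightarrow> (complex ^ 'n \<Rightarrow> complex) \<Rightarrow>
   (complex ^ 'n \<Rightarrow> complex) \<Rightarrow> complex ^ 'n \<Rightarrow> complex" where
  "truncated_toeplitz \<phi>1 \<phi>2 f = hardy_proj (model_space \<phi>1) (\<lambda>z. \<phi>2 z * f z)"

definition hardy_isometry_on ::
  "(complex ^ 'n \<Rightarrow> complex) set \<Rightarrow>
   ((complex ^ 'n \<Rightarrow> complex) \<Rightarrow> complex ^ 'n \<Rightarrow> complex) \<Rightarrow> bool" where
  "hardy_isometry_on S T \<longleftrightarrow> (\<forall>f\<in>S. hardy_norm (T f) = hardy_norm f)"

definition depends_on :: "(complex ^ 'n \<Rightarrow> complex) \<Rightarrow> 'n \<Rightarrow> bool" where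
  "depends_on f i \<longleftrightarrow>
     (\<exists>z\<in>polydisc. \<exists>w\<in>polydisc. (\<forall>j. j \<noteq> i \<longrightarrow> z $ j = w $ j) \<and> f z \<noteq> f w)"

definition separated :: "(complex ^ 'n \<Rightarrow> complex) \<Rightarrow> (complex ^ 'n \<Rightarrow> complex) \<Rightarrow> bool" where
  "separated f g \<longleftrightarrow> \<not> (\<exists>i. depends_on f i \<and> depends_on g i)"

end

theory Submission
  imports Defs "HOL-Complex_Analysis.Cauchy_Integral_Formula"
    "HOL-Probability.Infinite_Product_Measure" "HOL-Real_Asymp.Real_Asymp"
begin

text \<open>The proof replaces every analytic function by its family of Taylor coefficients, indexed by
multi-indices. Write $T_\varphi$ for multiplication by $\varphi$ on the Hardy space.

Cauchy's formula, iterated over the coordinates, gives the Taylor expansion of a function that is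
analytic in the polydisc (\<open>Taylor_polydisc\<close>), and orthonormality of the monomials on the torus
turns norm and inner product of the Hardy space into those of square summable families
(\<open>hardy_norm_has_sum\<close>, \<open>hardy_inner_tendsto\<close>). Conversely every square summable family belongs to
an element of the Hardy space (\<open>hardy2_power_series\<close>). Hence the adjoint $T_\varphi^*$ exists: the
coefficients of $T_\varphi^* f$ have to be $\langle f, \varphi z^k \rangle$, and they are square
summable by Bessel's argument (\<open>hardy_inner_mult_adjoint\<close>). The boundary values of an inner function
are used only once, to see that the functions $\varphi z^k$ are orthonormal; that $T_\varphi$ is an
isometry is then formal (\<open>inner_mult_isometry\<close>).

It follows that $f \mapsto f - T_{\varphi_1} T_{\varphi_1}^* f$ is the projection onto the model
space of $\varphi_1$. Multiplication by $\varphi_2$ preserves the norm, and a projection preserves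
the norm of a vector only if it fixes the vector. So the truncated Toeplitz operator is an
isometry if and only if $\varphi_2$ maps the model space of $\varphi_1$ into itself
(\<open>isometry_iff_invariant\<close>), and this happens if and only if
$T_{\varphi_2}^* T_{\varphi_1} = T_{\varphi_1} T_{\varphi_2}^*$ (\<open>invariant_iff_commuting\<close>).

Let $a$ and $b$ be the coefficients of $\varphi_1$ and $\varphi_2$. The matrix entries of the two
products are
\[ \sum_{\gamma \ge \alpha, \beta} a_{\gamma-\beta} \overline{b_{\gamma-\alpha}}
   \quad\mbox{and}\quad
   \sum_{\delta \le \alpha, \beta} a_{\alpha-\delta} \overline{b_{\beta-\delta}} . \]
The substitution $\gamma = \alpha + \beta - \delta$ identifies the second sum with the part of the
first in which $\gamma \le \alpha + \beta$. In each remaining term the indices $\gamma - \beta$ and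
$\gamma - \alpha$ are both positive in some coordinate. So the sums agree if $a_p \overline{b_q} = 0$
whenever $p_i, q_i > 0$ for some $i$ (\<open>separated_imp_commuting\<close>). For the converse, the first sum
does not change when $\alpha$ and $\beta$ are both increased by one in the coordinate $i$; comparing
the second sums and inducting on the degree of $p$ shows $a_p \overline{b_q} = 0$
(\<open>commuting_imp_separated\<close>). Finally $\varphi$ depends on $z_i$ if and only if some coefficient with
$p_i > 0$ is nonzero (\<open>depends_on_iff_coef\<close>), so the condition on $a$ and $b$ is separatedness.\<close>

section \<open>Integration over the torus\<close>

lemma measurable_cis [measurable]: "cis \<in> borel_measurable borel"
  by (intro borel_measurable_continuous_onI continuous_intros)

lemma measurable_cnj [measurable]: "cnj \<in> borel_measurable borel"
  by (intro borel_measurable_continuous_onI continuous_intros)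

lemma measurable_vec_nth [measurable]:
  "(\<lambda>z. z $ i) \<in> borel_measurable (borel :: (complex ^ 'n) measure)"
  by (intro borel_measurable_continuous_onI continuous_intros)

lemma prob_space_circle_measure: "prob_space circle_measure"
proof -
  interpret prob_space "uniform_measure lborel {0..2 * pi}"
    by (rule prob_space_uniform_measure) auto
  show ?thesis
    unfolding circle_measure_def
    by (rule prob_space_distr) (simp add: uniform_measure_def)
qed

lemma sets_circle_measure [simp, measurable_cong]: "sets circle_measure = sets borel"
  by (simp add: circle_measure_def)

lemma space_circle_measure [simp]: "space circle_measure = UNIV"
  by (simp add: circle_measure_def)

lemma AE_circle_measure: "AE z in circle_measure. norm z = 1"
  unfolding circle_measure_def by (subst AE_distr_iff) (auto simp: uniform_measure_def)

text \<open>The angle parametrization that contour integrals over the circle use as well.\<close>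

lemma integral_circle_measure:
  fixes f :: "complex \<Rightarrow> complex"
  assumes f: "f \<in> borel_measurable borel" and c: "continuous_on (sphere 0 1) f"
    and I: "((\<lambda>t. f (cis t)) has_integral I) {0..2*pi}"
  shows "(LINT z|circle_measure. f z) = I / (2 * pi)"
proof -
  have *: "(\<lambda>x. indicator {0..2*pi} x / emeasure lborel {0..2*pi}) =
      (\<lambda>x::real. ennreal (indicator {0..2*pi} x / (2*pi)))"
    using divide_ennreal[of 1 "2*pi"] by (auto simp: fun_eq_iff indicator_def)
  have cont: "continuous_on {0..2*pi} (\<lambda>t. f (cis t))"
    by (rule continuous_on_compose2[OF c]) (auto intro!: continuous_intros)
  have si: "set_integrable lborel {0..2*pi} (\<lambda>t. f (cis t))"
    by (rule borel_integrable_compact[unfolded set_integrable_def[symmetric]]) (use cont in auto)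
  have "(LINT z|circle_measure. f z) = (LINT t|uniform_measure lborel {0..2*pi}. f (cis t))"
    unfolding circle_measure_def using f by (subst integral_distr) auto
  also have "\<dots> = (LINT t|lborel. (indicator {0..2*pi} t / (2*pi)) *\<^sub>R f (cis t))"
    unfolding uniform_measure_def * using f by (subst integral_density) auto
  also have "\<dots> = (LINT t|lborel. (1 / (2*pi)) *\<^sub>R (indicator {0..2*pi} t *\<^sub>R f (cis t)))"
    by (simp add: mult.commute)
  also have "\<dots> = (1 / (2*pi)) *\<^sub>R (LINT t:{0..2*pi}|lborel. f (cis t))"
    unfolding set_lebesgue_integral_def by (rule integral_scaleR_right)
  also have "(LINT t:{0..2*pi}|lborel. f (cis t)) = integral {0..2*pi} (\<lambda>t. f (cis t))"
    by (rule set_borel_integral_eq_integral(2)[OF si])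
  also have "\<dots> = I" using I by (rule integral_unique)
  finally show ?thesis by (simp add: scaleR_conv_of_real)
qed

text \<open>Cauchy's integral formula: on the unit circle $d\zeta = i \zeta\, dt$ and
$\zeta / (\zeta - w) = 1 / (1 - w \overline\zeta)$, so the Cauchy kernel becomes a kernel against the
normalized arc length.\<close>

lemma circle_Cauchy_kernel:
  assumes h: "h holomorphic_on cball 0 1" and m: "h \<in> borel_measurable borel" and w: "norm w < 1"
  shows "(LINT z|circle_measure. h z / (1 - w * cnj z)) = h w"
proof -
  have "((\<lambda>u. h u / (u - w)) has_contour_integral 2 * pi * \<i> * h w) (part_circlepath 0 1 0 (2*pi))"
    using Cauchy_integral_circlepath_simple[OF h, of w] w by (simp add: circlepath_def)
  hence "((\<lambda>t. h (cis t) / (cis t - w) * \<i> * cis t) has_integral 2 * pi * \<i> * h w) {0..2*pi}"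
    by (subst (asm) has_contour_integral_part_circlepath_iff) auto
  hence "((\<lambda>t. (1/\<i>) * (h (cis t) / (cis t - w) * \<i> * cis t)) has_integral (1/\<i>) * (2 * pi * \<i> * h w))
      {0..2*pi}"
    by (rule has_integral_mult_right)
  also have "(1/\<i>) * (2 * pi * \<i> * h w) = 2 * pi * h w" by simp
  also have "(\<lambda>t. (1/\<i>) * (h (cis t) / (cis t - w) * \<i> * cis t)) = (\<lambda>t. h (cis t) / (1 - w * cnj (cis t)))"
  proof
    fix t
    have 1: "cis t * cnj (cis t) = 1" by (simp add: complex_norm_square[symmetric])
    have 2: "cis t - w \<noteq> 0" using w by (metis eq_iff_diff_eq_0 norm_cis less_irrefl)
    have "1 - w * cnj (cis t) = (cis t - w) * cnj (cis t)" using 1 by (simp add: algebra_simps)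
    moreover have "cnj (cis t) \<noteq> 0" by simp
    ultimately show "(1/\<i>) * (h (cis t) / (cis t - w) * \<i> * cis t) = h (cis t) / (1 - w * cnj (cis t))"
      using 2 by (simp add: divide_simps 1, simp add: mult.left_commute[of \<i> "h (cis t)"])
  qed
  finally have I: "((\<lambda>t. h (cis t) / (1 - w * cnj (cis t))) has_integral 2 * pi * h w) {0..2*pi}" .
  have nz: "1 - w * cnj z \<noteq> 0" if "norm z = 1" for z
  proof
    assume "1 - w * cnj z = 0"
    hence "norm (w * cnj z) = 1" by (metis eq_iff_diff_eq_0 norm_one)
    thus False using that w by (simp add: norm_mult)
  qed
  have "(LINT z|circle_measure. h z / (1 - w * cnj z)) = (2 * pi * h w) / (2 * pi)"
  proof (rule integral_circle_measure)
    show "(\<lambda>z. h z / (1 - w * cnj z)) \<in> borel_measurable borel"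
      using m by measurable
    show "continuous_on (sphere 0 1) (\<lambda>z. h z / (1 - w * cnj z))"
      using nz by (intro continuous_intros continuous_on_subset[OF
          holomorphic_on_imp_continuous_on[OF h]]) auto
  qed (use I in simp)
  thus ?thesis by simp
qed

text \<open>The kernel formula at $w = 0$ is the mean value property, which gives the integrals of powers; on the
circle $z^j \overline{z^j} = 1$ reduces the general case to it, up to conjugation.\<close>

lemma circle_orthonormal:
  "(LINT z|circle_measure. z ^ m * cnj (z ^ n)) = (if m = n then 1 else 0)"
proof -
  interpret prob_space circle_measure by (rule prob_space_circle_measure)
  have pow: "(LINT z|circle_measure. z ^ k) = (if k = 0 then 1 else 0)" for k
    using circle_Cauchy_kernel[of "\<lambda>z. z ^ k" 0] by (auto simp: holomorphic_on_power)
  have one: "z ^ j * cnj (z ^ j) = 1" if "norm z = 1" for j and z :: complex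
    using that by (simp add: complex_norm_square[symmetric] norm_power del: complex_cnj_power)
  show ?thesis
  proof (cases "n \<le> m")
    case True
    then obtain k where k: "m = n + k" using le_Suc_ex by blast
    have "(LINT z|circle_measure. z ^ m * cnj (z ^ n)) = (LINT z|circle_measure. z ^ k)"
    proof (rule integral_cong_AE)
      show "AE z in circle_measure. z ^ m * cnj (z ^ n) = z ^ k"
        using AE_circle_measure
      proof eventually_elim
        case (elim z)
        have "z ^ m * cnj (z ^ n) = z ^ k * (z ^ n * cnj (z ^ n))" by (simp add: k power_add)
        thus ?case by (simp only: one[OF elim] mult_1_right)
      qed
    qed auto
    thus ?thesis using pow k by simp
  next
    case False
    then obtain k where k: "n = m + k" "k \<noteq> 0" using le_Suc_ex[of m n] by auto
    have "(LINT z|circle_measure. z ^ m * cnj (z ^ n)) = (LINT z|circle_measure. cnj (z ^ k))"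
    proof (rule integral_cong_AE)
      show "AE z in circle_measure. z ^ m * cnj (z ^ n) = cnj (z ^ k)"
        using AE_circle_measure
      proof eventually_elim
        case (elim z)
        have "z ^ m * cnj (z ^ n) = cnj (z ^ k) * (z ^ m * cnj (z ^ m))" by (simp add: k power_add)
        thus ?case by (simp only: one[OF elim] mult_1_right)
      qed
    qed auto
    also have "\<dots> = cnj (LINT z|circle_measure. z ^ k)" by (rule Bochner_Integration.integral_cnj)
    finally show ?thesis using pow k by simp
  qed
qed

lemma product_sigma_finite_circle: "product_sigma_finite (\<lambda>_::'n. circle_measure)"
  using prob_space_circle_measure
  by (simp add: product_sigma_finite_def prob_space_imp_sigma_finite)

lemma measurable_vec_borel:
  fixes f :: "'a \<Rightarrow> complex ^ 'n"
  assumes "\<And>i. (\<lambda>x. f x $ i) \<in> borel_measurable M"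
  shows "f \<in> borel_measurable M"
proof (subst borel_measurable_euclidean_space, rule ballI)
  fix b :: "complex ^ 'n" assume "b \<in> Basis"
  then obtain i c where b: "b = axis i c" by (auto simp: Basis_vec_def)
  show "(\<lambda>x. f x \<bullet> b) \<in> borel_measurable M"
    using assms[of i] by (simp add: b inner_axis)
qed

lemma measurable_vec_lambda_circle [measurable]:
  "vec_lambda \<in> measurable (PiM UNIV (\<lambda>_::'n. circle_measure)) (borel :: (complex ^ 'n) measure)"
  by (rule measurable_vec_borel) simp

lemma sets_torus_measure [simp, measurable_cong]: "sets torus_measure = sets borel"
  by (simp add: torus_measure_def)

lemma space_torus_measure [simp]: "space torus_measure = UNIV"
  by (simp add: torus_measure_def)

lemma prob_space_torus_measure: "prob_space torus_measure"
proof -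
  interpret product_prob_space "\<lambda>_::'n. circle_measure" UNIV
    using prob_space_circle_measure product_sigma_finite_circle
    by (simp add: product_prob_space_def product_prob_space_axioms_def)
  show ?thesis
    unfolding torus_measure_def by (rule prob_space_distr) simp
qed

lemma AE_circle_product:
  assumes "finite I"
  shows "AE x in PiM I (\<lambda>_::'n. circle_measure). \<forall>i\<in>I. norm (x i) = 1"
  using assms AE_circle_measure prob_space_circle_measure
  by (intro AE_finite_allI AE_PiM_component)

lemma AE_torus_measure: "AE z in (torus_measure :: (complex ^ 'n) measure). \<forall>i. norm (z $ i) = 1"
proof -
  have "AE x in PiM UNIV (\<lambda>_::'n. circle_measure). \<forall>i\<in>UNIV. norm (x i) = 1"
    by (rule AE_circle_product) simp
  thus ?thesis
    unfolding torus_measure_def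
    by (subst AE_distr_iff) auto
qed

lemma integral_torus_measure:
  fixes f :: "complex ^ 'n \<Rightarrow> complex"
  assumes "f \<in> borel_measurable borel"
  shows "(LINT z|torus_measure. f z) = (LINT x|PiM UNIV (\<lambda>_. circle_measure). f (vec_lambda x))"
  using assms unfolding torus_measure_def by (subst integral_distr) auto

section \<open>Cauchy's formula on the polydisc\<close>

text \<open>Analytic functions on the polydisc, extended by 0 as in \<^const>\<open>hardy2\<close>. The extension is Borel
measurable on the whole space, which integrals over the torus measure require.\<close>

definition analytic0 :: "(complex ^ 'n \<Rightarrow> complex) set" where
  "analytic0 = {f. analytic_on_polydisc f \<and> (\<forall>z. z \<notin> polydisc \<longrightarrow> f z = 0)}"

definition zpow :: "('n \<Rightarrow> nat) \<Rightarrow> complex ^ 'n \<Rightarrow> complex" where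
  "zpow k z = (\<Prod>i\<in>UNIV. (z $ i) ^ k i)"

definition tdeg :: "('n::finite \<Rightarrow> nat) \<Rightarrow> nat" where
  "tdeg k = (\<Sum>i\<in>UNIV. k i)"

lemma open_polydisc: "open (polydisc :: (complex ^ 'n) set)"
proof -
  have "polydisc = (\<Inter>i. {z :: complex ^ 'n. norm (z $ i) < 1})"
    by (auto simp: polydisc_def)
  then show ?thesis
    by (rule ssubst) (intro open_INT ballI open_Collect_less continuous_intros finite)
qed

lemma compact_closed_polydisc: "compact {z :: complex ^ 'n. \<forall>i. norm (z $ i) \<le> r}"
proof -
  have "{z :: complex ^ 'n. \<forall>i. norm (z $ i) \<le> r} = (\<Inter>i. {z. norm (z $ i) \<le> r})"
    by auto
  hence "closed {z :: complex ^ 'n. \<forall>i. norm (z $ i) \<le> r}"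
    by (auto intro!: closed_INT closed_Collect_le continuous_intros)
  moreover have "bounded {z :: complex ^ 'n. \<forall>i. norm (z $ i) \<le> r}"
  proof (rule boundedI)
    fix z :: "complex ^ 'n" assume "z \<in> {z. \<forall>i. norm (z $ i) \<le> r}"
    hence "(\<Sum>i\<in>UNIV. norm (z $ i)) \<le> (\<Sum>i\<in>(UNIV::'n set). r)" by (intro sum_mono) auto
    moreover have "norm z \<le> (\<Sum>i\<in>UNIV. norm (z $ i))"
      unfolding norm_vec_def by (rule L2_set_le_sum) auto
    ultimately show "norm z \<le> (\<Sum>i\<in>(UNIV::'n set). r)" by linarith
  qed
  ultimately show ?thesis by (simp add: compact_eq_bounded_closed)
qed

lemma scaleR_in_polydisc:
  assumes "0 \<le> r" "r < 1" "\<And>i. norm (z $ i) \<le> 1"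
  shows "r *\<^sub>R z \<in> polydisc"
  unfolding polydisc_def
proof (safe, simp)
  fix i
  have "r * norm (z $ i) \<le> r" using assms by (simp add: mult_left_le)
  thus "\<bar>r\<bar> * norm (z $ i) < 1" using assms by simp
qed

lemma analytic_continuous: "analytic_on_polydisc f \<Longrightarrow> continuous_on polydisc f"
  unfolding analytic_on_polydisc_def
  by (meson continuous_at_imp_continuous_on has_derivative_continuous)

lemma analytic0_measurable [measurable_dest]:
  assumes "f \<in> analytic0"
  shows "f \<in> borel_measurable borel"
proof -
  have "(\<lambda>z. if z \<in> polydisc then f z else 0) \<in> borel_measurable borel"
    using assms analytic_continuous[of f]
    by (intro borel_measurable_continuous_on_if borel_open[OF open_polydisc]) (auto simp: analytic0_def)
  also have "(\<lambda>z. if z \<in> polydisc then f z else 0) = f"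
    using assms by (auto simp: analytic0_def)
  finally show ?thesis .
qed

lemma analytic0_bounded:
  assumes "f \<in> analytic0" "0 \<le> r" "r < 1"
  obtains B where "0 \<le> B" "\<And>z. (\<And>i. norm (z $ i) \<le> 1) \<Longrightarrow> norm (f (r *\<^sub>R z)) \<le> B"
proof -
  let ?K = "{z :: complex ^ 'a. \<forall>i. norm (z $ i) \<le> r}"
  have "?K \<subseteq> polydisc" using assms(3) by (fastforce simp: polydisc_def intro: le_less_trans)
  hence "continuous_on ?K f"
    using assms(1) analytic_continuous[of f] by (auto simp: analytic0_def intro: continuous_on_subset)
  hence "bounded (f ` ?K)"
    using compact_closed_polydisc by (intro compact_imp_bounded compact_continuous_image)
  then obtain B where B: "0 < B" "\<And>x. x \<in> ?K \<Longrightarrow> norm (f x) \<le> B"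
    unfolding bounded_pos by auto
  show ?thesis
  proof (rule that[of B])
    fix z :: "complex ^ 'a" assume z: "\<And>i. norm (z $ i) \<le> 1"
    have "r *\<^sub>R z \<in> ?K" using z assms by (auto simp: mult_left_le)
    thus "norm (f (r *\<^sub>R z)) \<le> B" by (rule B)
  qed (use B in simp)
qed

text \<open>By the chain rule the slice has the derivative $v \mapsto f'(v e_i)$, and complex linearity of $f'$
makes it multiplication by the number $f'(e_i)$.\<close>

lemma analytic_slice:
  fixes f :: "complex ^ 'n \<Rightarrow> complex"
  assumes "analytic_on_polydisc f" and z: "\<And>j. j \<noteq> i \<Longrightarrow> norm (z $ j) < 1"
  shows "(\<lambda>y. f (\<chi> j. if j = i then y else z $ j)) holomorphic_on ball 0 1"
proof -
  have "\<exists>D. ((\<lambda>y. f (\<chi> j. if j = i then y else z $ j)) has_field_derivative D) (at y)"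
    if y: "y \<in> ball 0 1" for y
  proof -
    let ?u = "\<lambda>y. (\<chi> j. if j = i then y else z $ j) :: complex ^ 'n"
    have "?u y \<in> polydisc" using z y by (auto simp: polydisc_def)
    then obtain f' where f': "(f has_derivative f') (at (?u y))" "\<And>c v. f' (c *s v) = c * f' v"
      using assms(1) unfolding analytic_on_polydisc_def by blast
    have "((\<lambda>y. ?u y $ j) has_derivative (\<lambda>v. (v *s axis i 1 :: complex ^ 'n) $ j)) (at y)" for j
      by (cases "j = i") (auto simp: axis_def intro!: derivative_eq_intros)
    hence "(?u has_derivative (\<lambda>v. v *s axis i 1)) (at y)"
      by (subst has_derivative_componentwise_within) 
         (auto simp: Basis_vec_def inner_axis intro!: derivative_intros)
    from has_derivative_compose[OF this f'(1)]
    have "((\<lambda>y. f (?u y)) has_derivative (\<lambda>v. f' (axis i 1) * v)) (at y)"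
      by (simp add: f'(2) mult.commute)
    thus ?thesis unfolding has_field_derivative_def by blast
  qed
  thus ?thesis
    by (auto simp: holomorphic_on_open)
qed

lemma one_minus_mult_cnj_bound:
  assumes "norm (w::complex) < 1" "norm x = 1"
  shows "norm (1 / (1 - w * cnj x)) \<le> 1 / (1 - norm w)"
proof -
  have "1 - norm w \<le> norm (1 - w * cnj x)"
    using norm_triangle_ineq2[of 1 "w * cnj x"] assms by (simp add: norm_mult)
  thus ?thesis using assms by (simp add: norm_divide frac_le)
qed

text \<open>Cauchy's formula in the coordinates in \<open>I\<close>, by induction with Fubini's theorem: integrating
out one coordinate is the one-variable formula for a slice. The indicator functions confine the
integrand to the torus, where it is bounded and its slices are analytic. Without them the inner
integral would be known only for almost all values of the other coordinates.\<close>

lemma partial_Cauchy_kernel: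
  fixes f :: "complex ^ 'n \<Rightarrow> complex"
  assumes f: "f \<in> analytic0" and r: "0 \<le> r" "r < 1" and w: "w \<in> polydisc" and I: "finite I"
  shows "(LINT x|PiM I (\<lambda>_. circle_measure). f (r *\<^sub>R (\<chi> i. if i \<in> I then x i else w $ i)) *
            (\<Prod>i\<in>I. indicator (sphere 0 1) (x i) / (1 - w $ i * cnj (x i)))) = f (r *\<^sub>R w)"
  using I
proof induction
  case empty
  interpret prob_space "PiM ({}::'n set) (\<lambda>_. circle_measure)"
    using prob_space_circle_measure by (intro prob_space_PiM)
  show ?case by (simp add: vec_lambda_eta prob_space)
next
  case (insert i I)
  interpret product_sigma_finite "\<lambda>_::'n. circle_measure" by (rule product_sigma_finite_circle)
  interpret C: prob_space circle_measure by (rule prob_space_circle_measure)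
  let ?G = "\<lambda>I x. f (r *\<^sub>R (\<chi> i. if i \<in> I then x i else w $ i)) *
            (\<Prod>i\<in>I. indicator (sphere 0 1) (x i) / (1 - w $ i * cnj (x i)))"
  let ?P = "PiM (insert i I) (\<lambda>_. circle_measure)"
  interpret P: prob_space ?P using prob_space_circle_measure by (intro prob_space_PiM)
  note f[THEN analytic0_measurable, measurable]
  have w1: "norm (w $ j) < 1" for j using w by (auto simp: polydisc_def)
  have [measurable]: "(\<lambda>x. r *\<^sub>R (\<chi> j. if j \<in> insert i I then x j else w $ j)) \<in> borel_measurable ?P"
  proof (rule measurable_vec_borel)
    fix j
    show "(\<lambda>x. (r *\<^sub>R (\<chi> j. if j \<in> insert i I then x j else w $ j)) $ j) \<in> borel_measurable ?P"
      by (cases "j \<in> insert i I") simp_all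
  qed
  have [measurable]: "indicator (sphere (0::complex) 1) \<in> borel_measurable borel"
    by (intro borel_measurable_indicator) simp
  have meas: "?G (insert i I) \<in> borel_measurable ?P"
    by measurable
  obtain B where B: "0 \<le> B" "\<And>z. (\<And>i. norm (z $ i) \<le> 1) \<Longrightarrow> norm (f (r *\<^sub>R z)) \<le> B"
    using analytic0_bounded[OF f r] by blast
  have "norm (?G (insert i I) x) \<le> B * (\<Prod>j\<in>insert i I. 1 / (1 - norm (w $ j)))" for x
  proof (cases "\<forall>j\<in>insert i I. norm (x j) = 1")
    case True
    have "norm (f (r *\<^sub>R (\<chi> j. if j \<in> insert i I then x j else w $ j))) \<le> B"
      using True w1 by (intro B(2)) (auto intro: less_imp_le)
    moreover have "norm (\<Prod>j\<in>insert i I. indicator (sphere 0 1) (x j) / (1 - w $ j * cnj (x j)))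
        \<le> (\<Prod>j\<in>insert i I. 1 / (1 - norm (w $ j)))"
      unfolding prod_norm[symmetric] using True one_minus_mult_cnj_bound[OF w1]
      by (intro prod_mono) auto
    ultimately show ?thesis unfolding norm_mult using B(1) by (intro mult_mono) auto
  next
    case False
    then obtain j where j: "j \<in> insert i I" "norm (x j) \<noteq> 1" by auto
    hence "(\<Prod>i\<in>insert i I. indicator (sphere 0 1) (x i) / (1 - w $ i * cnj (x i))) = (0::complex)"
      using insert.hyps by (intro prod_zero bexI[OF _ j(1)]) auto
    moreover have "0 \<le> B * (\<Prod>j\<in>insert i I. 1 / (1 - norm (w $ j)))"
      using B(1) w1 by (intro mult_nonneg_nonneg prod_nonneg) (auto intro: less_imp_le)
    ultimately show ?thesis by (simp only: mult_zero_right norm_zero)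
  qed
  hence int: "integrable ?P (?G (insert i I))"
    by (intro P.integrable_const_bound[OF _ meas]) auto
  have "(LINT y|circle_measure. ?G (insert i I) (x(i := y))) = ?G I x" for x
  proof (cases "\<forall>j\<in>I. norm (x j) = 1")
    case True
    define u where "u = (\<chi> j. if j \<in> I then x j else w $ j)"
    define c where "c = (\<Prod>i\<in>I. indicator (sphere 0 1) (x i) / (1 - w $ i * cnj (x i)) :: complex)"
    define h where "h = (\<lambda>y. f (r *\<^sub>R (\<chi> j. if j = i then y else u $ j)))"
    have eq1: "(\<chi> j. if j \<in> insert i I then (x(i := y)) j else w $ j)
        = (\<chi> j. if j = i then y else u $ j)" for y
      using insert.hyps by (auto simp: u_def vec_eq_iff)
    have eq2: "(\<Prod>j\<in>insert i I. indicator (sphere 0 1) ((x(i := y)) j) / (1 - w $ j * cnj ((x(i := y)) j)))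
        = indicator (sphere 0 1) y / (1 - w $ i * cnj y) * c" for y
      using insert.hyps unfolding c_def by (auto intro!: arg_cong2[where f="(*)"] prod.cong)
    have u: "norm (u $ j) \<le> 1" for j using True w1[of j] by (auto simp: u_def)
    have "norm (((r *\<^sub>R u) $ j)) < 1" for j
      using scaleR_in_polydisc[OF r u] by (auto simp: polydisc_def)
    hence "(\<lambda>y. f (\<chi> j. if j = i then y else (r *\<^sub>R u) $ j)) holomorphic_on ball 0 1"
      using f by (intro analytic_slice) (auto simp: analytic0_def)
    hence "((\<lambda>y. f (\<chi> j. if j = i then y else (r *\<^sub>R u) $ j)) \<circ> (\<lambda>y. of_real r * y)) holomorphic_on
        cball 0 1"
    proof (rule holomorphic_on_compose_gen[rotated])
      show "(\<lambda>y. of_real r * y) ` cball 0 1 \<subseteq> ball (0::complex) 1"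
      proof safe
        fix y :: complex assume "y \<in> cball 0 1"
        hence "\<bar>r\<bar> * norm y \<le> \<bar>r\<bar>" by (simp add: mult_left_le)
        thus "of_real r * y \<in> ball 0 1" using r by (simp add: norm_mult)
      qed
    qed (intro holomorphic_intros)
    also have "((\<lambda>y. f (\<chi> j. if j = i then y else (r *\<^sub>R u) $ j)) \<circ> (\<lambda>y. of_real r * y)) = h"
      by (auto simp: fun_eq_iff h_def scaleR_conv_of_real[where 'a=complex] vec_eq_iff intro!:
          arg_cong[where f=f])
    finally have hol: "h holomorphic_on cball 0 1" .
    have hm [measurable]: "h \<in> borel_measurable borel"
    proof -
      have [measurable]: "(\<lambda>y. r *\<^sub>R (\<chi> j. if j = i then y else u $ j)) \<in> borel_measurable borel"
        by (rule measurable_vec_borel) (auto intro!: borel_measurable_scaleR)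
      show ?thesis unfolding h_def by measurable
    qed
    have "(LINT y|circle_measure. ?G (insert i I) (x(i := y))) =
        (LINT y|circle_measure. h y * (indicator (sphere 0 1) y / (1 - w $ i * cnj y) * c))"
      unfolding eq1 eq2 h_def ..
    also have "\<dots> = (LINT y|circle_measure. h y / (1 - w $ i * cnj y) * c)"
    proof (rule integral_cong_AE)
      show "AE y in circle_measure. h y * (indicator (sphere 0 1) y / (1 - w $ i * cnj y) * c) =
          h y / (1 - w $ i * cnj y) * c"
        using AE_circle_measure by eventually_elim auto
    qed measurable
    also have "\<dots> = h (w $ i) * c"
      by (simp only: integral_mult_left_zero circle_Cauchy_kernel[OF hol hm w1])
    also have "h (w $ i) = f (r *\<^sub>R u)"
      unfolding h_def using insert.hyps by (auto intro!: arg_cong[where f=f] simp: vec_eq_iff u_def)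
    finally show ?thesis by (simp add: u_def c_def)
  next
    case False
    then obtain j where j: "j \<in> I" "norm (x j) \<noteq> 1" by auto
    hence "j \<noteq> i" using insert.hyps by auto
    have "(\<Prod>i\<in>I. indicator (sphere 0 1) (x i) / (1 - w $ i * cnj (x i))) = (0::complex)"
      using insert.hyps j by (intro prod_zero bexI[of _ j]) auto
    moreover have "(\<Prod>k\<in>insert i I. indicator (sphere 0 1) ((x(i := y)) k) / (1 - w $ k
        * cnj ((x(i := y)) k))) = (0::complex)" for y
      using insert.hyps j \<open>j \<noteq> i\<close> by (intro prod_zero bexI[of _ j]) auto
    ultimately show ?thesis by (simp only: mult_zero_right integral_zero)
  qed
  thus ?case
    using product_integral_insert[OF insert.hyps int] insert.IH by simp
qed

lemma torus_Cauchy_kernel: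
  fixes f :: "complex ^ 'n \<Rightarrow> complex"
  assumes f: "f \<in> analytic0" and r: "0 \<le> r" "r < 1" and w: "w \<in> polydisc"
  shows "(LINT z|torus_measure. f (r *\<^sub>R z) * (\<Prod>i\<in>UNIV. 1 / (1 - w $ i * cnj (z $ i)))) = f (r *\<^sub>R w)"
proof -
  let ?P = "PiM UNIV (\<lambda>_::'n. circle_measure)"
  note f[THEN analytic0_measurable, measurable]
  have [measurable]: "indicator (sphere (0::complex) 1) \<in> borel_measurable borel"
    by (intro borel_measurable_indicator) simp
  have "(LINT z|torus_measure. f (r *\<^sub>R z) * (\<Prod>i\<in>UNIV. 1 / (1 - w $ i * cnj (z $ i)))) =
      (LINT x|?P. f (r *\<^sub>R vec_lambda x) * (\<Prod>i\<in>UNIV. 1 / (1 - w $ i * cnj (vec_lambda x $ i))))"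
    by (rule integral_torus_measure) measurable
  also have "\<dots> = (LINT x|?P. f (r *\<^sub>R vec_lambda x) *
       (\<Prod>i\<in>UNIV. indicator (sphere 0 1) (x i) / (1 - w $ i * cnj (x i))))"
  proof (rule integral_cong_AE)
    show "AE x in ?P. f (r *\<^sub>R vec_lambda x) * (\<Prod>i\<in>UNIV. 1 / (1 - w $ i * cnj (vec_lambda x $ i))) =
      f (r *\<^sub>R vec_lambda x) * (\<Prod>i\<in>UNIV. indicator (sphere 0 1) (x i) / (1 - w $ i * cnj (x i)))"
      using AE_circle_product[of "UNIV::'n set"] by (auto elim!: eventually_mono)
  qed measurable
  also have "\<dots> = f (r *\<^sub>R w)"
    using partial_Cauchy_kernel[OF f r w, of UNIV] by simp
  finally show ?thesis .
qed

lemma zpow_orthonormal: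
  "(LINT z|torus_measure. zpow k z * cnj (zpow l z)) = (if k = l then 1 else 0)"
proof -
  interpret product_sigma_finite "\<lambda>_::'a. circle_measure" by (rule product_sigma_finite_circle)
  interpret C: prob_space circle_measure by (rule prob_space_circle_measure)
  have int: "integrable circle_measure (\<lambda>z. z ^ m * cnj (z ^ n))" for m n
  proof (rule C.integrable_const_bound[of _ 1])
    show "AE z in circle_measure. norm (z ^ m * cnj (z ^ n)) \<le> 1"
      using AE_circle_measure by eventually_elim (simp add: norm_mult norm_power)
  qed measurable
  have "(LINT z|torus_measure. zpow k z * cnj (zpow l z)) =
      (LINT x|PiM UNIV (\<lambda>_. circle_measure). (\<Prod>i\<in>UNIV. x i ^ k i * cnj (x i ^ l i)))"
    unfolding zpow_def by (subst integral_torus_measure) (auto simp: prod.distrib)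
  also have "\<dots> = (\<Prod>i\<in>UNIV. LINT z|circle_measure. z ^ k i * cnj (z ^ l i))"
    using int by (intro product_integral_prod) auto
  also have "\<dots> = (\<Prod>i\<in>UNIV. if k i = l i then 1 else 0)"
    unfolding circle_orthonormal ..
  also have "\<dots> = (if k = l then 1 else 0)"
    by (auto simp: fun_eq_iff)
  finally show ?thesis .
qed

section \<open>Expansion of the Cauchy kernel\<close>

text \<open>The notation \<open>abs_summable_on\<close> shall refer to \<^const>\<open>Infinite_Sum.abs_summable_on\<close>.\<close>

no_notation Infinite_Set_Sum.abs_summable_on (infix \<open>abs'_summable'_on\<close> 50)

text \<open>The families below are indexed by multi-indices, so convergence is along finite sets of indices.\<close>

lemma tail_tendsto_0:
  fixes B :: "'k \<Rightarrow> real"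
  assumes "B summable_on UNIV"
  shows "((\<lambda>F. infsum B UNIV - sum B F) \<longlongrightarrow> 0) (finite_subsets_at_top UNIV)"
  using tendsto_diff[OF tendsto_const infsum_tendsto[OF assms], of "infsum B UNIV"] by simp

lemma has_sum_tail_bound:
  fixes g :: "'k \<Rightarrow> 'b::banach" and B :: "'k \<Rightarrow> real"
  assumes g: "(g has_sum S) UNIV" and B: "B summable_on UNIV"
    and le: "\<And>k. norm (g k) \<le> B k" and F: "finite F"
  shows "norm (sum g F - S) \<le> infsum B UNIV - sum B F"
proof -
  have "norm (S - sum g F) \<le> infsum B UNIV - sum B F"
  proof (rule norm_infsum_le)
    show "(g has_sum (S - sum g F)) (UNIV - F)"
      using g F by (intro has_sum_Diff) auto
    show "(B has_sum (infsum B UNIV - sum B F)) (UNIV - F)"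
      using B F by (intro has_sum_Diff) auto
  qed (rule le)
  thus ?thesis by (simp add: norm_minus_commute)
qed

text \<open>Termwise integration: the tails of the majorant bound the error uniformly, hence also its integral.\<close>

lemma (in prob_space) has_sum_integral:
  fixes g :: "'k \<Rightarrow> 'a \<Rightarrow> complex"
  assumes gm [measurable]: "\<And>k. g k \<in> borel_measurable M" and Gm [measurable]: "G \<in> borel_measurable M"
    and B: "B summable_on UNIV" and le: "AE x in M. \<forall>k. norm (g k x) \<le> B k"
    and sum: "AE x in M. ((\<lambda>k. g k x) has_sum G x) UNIV"
  shows "((\<lambda>k. LINT x|M. g k x) has_sum (LINT x|M. G x)) UNIV"
proof -
  have gi: "integrable M (g k)" for k
    using le by (intro integrable_const_bound[of _ "B k"]) auto
  have tail: "AE x in M. norm ((\<Sum>k\<in>F. g k x) - G x) \<le> infsum B UNIV - sum B F" if "finite F" for F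
    using le sum
    by eventually_elim (rule has_sum_tail_bound[OF _ B], use that in auto)
  have Gi: "integrable M G"
    using tail[of "{}"] by (intro integrable_const_bound[of _ "infsum B UNIV"]) auto
  have "norm ((\<Sum>k\<in>F. LINT x|M. g k x) - (LINT x|M. G x)) \<le> infsum B UNIV - sum B F" if "finite F" for F
  proof -
    have "(\<Sum>k\<in>F. LINT x|M. g k x) - (LINT x|M. G x) = (LINT x|M. (\<Sum>k\<in>F. g k x) - G x)"
      using gi Gi by (simp add: Bochner_Integration.integral_sum)
    also have "norm \<dots> \<le> (LINT x|M. norm ((\<Sum>k\<in>F. g k x) - G x))"
      by (rule integral_norm_bound)
    also have "\<dots> \<le> (LINT x|M. infsum B UNIV - sum B F)"
      using tail[OF that] gi Gi by (intro integral_mono_AE) auto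
    finally show ?thesis by (simp add: prob_space)
  qed
  hence "\<forall>\<^sub>F F in finite_subsets_at_top UNIV.
      norm ((\<Sum>k\<in>F. LINT x|M. g k x) - (LINT x|M. G x)) \<le> infsum B UNIV - sum B F"
    by (intro eventually_finite_subsets_at_top_weakI) auto
  hence "((\<lambda>F. (\<Sum>k\<in>F. LINT x|M. g k x) - (LINT x|M. G x)) \<longlongrightarrow> 0) (finite_subsets_at_top UNIV)"
    by (rule Lim_null_comparison[OF _ tail_tendsto_0[OF B]])
  thus ?thesis unfolding has_sum_def by (simp add: LIM_zero_iff)
qed

lemma norm_zpow: "norm (zpow k z) = (\<Prod>i\<in>UNIV. norm (z $ i) ^ k i)"
  by (simp add: zpow_def prod_norm[symmetric] norm_power)

lemma norm_zpow_torus: "(\<And>i. norm (z $ i) = 1) \<Longrightarrow> norm (zpow k z) = 1"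
  by (simp add: norm_zpow)

lemma norm_zpow_le: 
  assumes "\<And>i. norm (z $ i) \<le> s"
  shows "norm (zpow k z) \<le> s ^ tdeg k"
proof -
  have "(\<Prod>i\<in>UNIV. norm (z $ i) ^ k i) \<le> (\<Prod>i\<in>UNIV. s ^ k i)"
    using assms by (intro prod_mono) (auto intro: power_mono)
  thus ?thesis by (simp add: norm_zpow tdeg_def power_sum)
qed

lemma zpow_scaleR: "zpow k (r *\<^sub>R z) = of_real r ^ tdeg k * zpow k z"
  unfolding zpow_def tdeg_def by (simp add: scaleR_conv_of_real[where 'a=complex] power_mult_distrib
      prod.distrib power_sum)

lemma zpow_const: "zpow k (\<chi> i. c) = c ^ tdeg k"
  by (simp add: zpow_def tdeg_def power_sum)

lemma zpow_measurable [measurable]: "zpow k \<in> borel_measurable borel"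
  unfolding zpow_def by measurable

text \<open>A finite set of multi-indices lies in a box, and the sum over a box factors into partial sums of
one-variable geometric series; this bounds all finite sums of the absolute values.\<close>

lemma geometric_has_sum:
  fixes x :: "'n::finite \<Rightarrow> complex"
  assumes x: "\<And>i. norm (x i) < 1"
  shows "((\<lambda>k. \<Prod>i\<in>UNIV. x i ^ k i) has_sum (\<Prod>i\<in>UNIV. 1 / (1 - x i))) UNIV"
    and "(\<lambda>k. \<Prod>i\<in>UNIV. x i ^ k i) abs_summable_on UNIV"
proof -
  have one: "summable (\<lambda>m. norm (x i ^ m))" for i
    using x by (simp add: norm_power)
  show abs: "(\<lambda>k. \<Prod>i\<in>UNIV. x i ^ k i) abs_summable_on UNIV"
  proof (rule nonneg_bdd_above_summable_on)
    have "(\<Sum>k\<in>F. norm (\<Prod>i\<in>UNIV. x i ^ k i)) \<le> (\<Prod>i\<in>UNIV. \<Sum>m. norm (x i ^ m))" if F: "finite F" for F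
    proof -
      define N where "N = Max (insert 0 ((\<lambda>(k, i). k i) ` (F \<times> UNIV)))"
      have N: "k i \<le> N" if "k \<in> F" for k i
        unfolding N_def using that F by (intro Max_ge) (auto intro!: image_eqI[of _ _ "(k, i)"])
      have "(\<Sum>k\<in>F. norm (\<Prod>i\<in>UNIV. x i ^ k i)) \<le>
          (\<Sum>k\<in>PiE UNIV (\<lambda>_. {..N}). norm (\<Prod>i\<in>UNIV. x i ^ k i))"
        using N by (intro sum_mono2 finite_PiE) auto
      also have "\<dots> = (\<Sum>k\<in>PiE UNIV (\<lambda>_. {..N}). \<Prod>i\<in>UNIV. norm (x i ^ k i))"
        by (simp add: prod_norm)
      also have "\<dots> = (\<Prod>i\<in>UNIV. \<Sum>m\<le>N. norm (x i ^ m))"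
        by (rule prod_sum_PiE[symmetric]) auto
      also have "\<dots> \<le> (\<Prod>i\<in>UNIV. \<Sum>m. norm (x i ^ m))"
        using one by (intro prod_mono conjI sum_nonneg sum_le_suminf) auto
      finally show ?thesis .
    qed
    thus "bdd_above (sum (\<lambda>k. norm (\<Prod>i\<in>UNIV. x i ^ k i)) ` {F. F \<subseteq> UNIV \<and> finite F})"
      by (auto intro!: bdd_aboveI)
  qed simp
  have "infsum (\<lambda>k. \<Prod>i\<in>UNIV. x i ^ k i) (PiE UNIV (\<lambda>_. UNIV)) = (\<Prod>i\<in>UNIV. infsum (\<lambda>m. x i ^ m) UNIV)"
    using one by (intro infsum_prod_PiE_abs) (auto simp: summable_on_UNIV_nonneg_real_iff)
  also have "\<dots> = (\<Prod>i\<in>UNIV. 1 / (1 - x i))"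
    using one geometric_sums[OF x]
    by (intro prod.cong refl infsumI norm_summable_imp_has_sum) auto
  finally show "((\<lambda>k. \<Prod>i\<in>UNIV. x i ^ k i) has_sum (\<Prod>i\<in>UNIV. 1 / (1 - x i))) UNIV"
    using abs_summable_summable[OF abs] by (simp add: has_sum_iff)
qed

lemma summable_power_tdeg:
  assumes "0 \<le> (s::real)" "s < 1"
  shows "(\<lambda>k::'n::finite \<Rightarrow> nat. s ^ tdeg k) summable_on UNIV"
  using geometric_has_sum(2)[of "\<lambda>_::'n. complex_of_real s"] assms
  by (simp add: prod_norm[symmetric] norm_power tdeg_def power_sum)

text \<open>Expand the Cauchy kernel into the geometric series $\sum_k w^k \overline{\zeta^k}$ and integrate
termwise.\<close>

lemma Taylor_scaled:
  fixes f :: "complex ^ 'n \<Rightarrow> complex"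
  assumes f: "f \<in> analytic0" and r: "0 \<le> r" "r < 1" and w: "w \<in> polydisc"
  shows "((\<lambda>k. (LINT z|torus_measure. f (r *\<^sub>R z) * cnj (zpow k z)) * zpow k w) has_sum f (r *\<^sub>R w)) UNIV"
proof -
  interpret prob_space "torus_measure :: (complex ^ 'n) measure" by (rule prob_space_torus_measure)
  note f[THEN analytic0_measurable, measurable]
  obtain B where B: "0 \<le> B" "\<And>z. (\<And>i. norm (z $ i) \<le> 1) \<Longrightarrow> norm (f (r *\<^sub>R z)) \<le> B"
    using analytic0_bounded[OF f r] by blast
  have w1: "norm (w $ i) < 1" for i using w by (auto simp: polydisc_def)
  have "((\<lambda>k. LINT z|torus_measure. f (r *\<^sub>R z) * (zpow k w * cnj (zpow k z))) has_sum
      (LINT z|torus_measure. f (r *\<^sub>R z) * (\<Prod>i\<in>UNIV. 1 / (1 - w $ i * cnj (z $ i))))) UNIV"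
  proof (rule has_sum_integral)
    show "(\<lambda>k. B * norm (zpow k w)) summable_on UNIV"
      using geometric_has_sum(2)[of "\<lambda>i. w $ i"] w1
      by (intro summable_on_cmult_right) (simp add: zpow_def)
    show "AE z in torus_measure. \<forall>k. norm (f (r *\<^sub>R z) * (zpow k w * cnj (zpow k z))) \<le> B * norm (zpow k w)"
      using AE_torus_measure
      by eventually_elim (auto simp: norm_mult norm_zpow_torus intro!: mult_right_mono B)
    show "AE z in torus_measure. ((\<lambda>k. f (r *\<^sub>R z) * (zpow k w * cnj (zpow k z))) has_sum
        f (r *\<^sub>R z) * (\<Prod>i\<in>UNIV. 1 / (1 - w $ i * cnj (z $ i)))) UNIV"
      using AE_torus_measure
    proof eventually_elim
      case (elim z)
      have "((\<lambda>k. \<Prod>i\<in>UNIV. (w $ i * cnj (z $ i)) ^ k i)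
          has_sum (\<Prod>i\<in>UNIV. 1 / (1 - w $ i * cnj (z $ i)))) UNIV"
        using elim w1 by (intro geometric_has_sum) (auto simp: norm_mult)
      thus ?case by (intro has_sum_cmult_right) (simp add: zpow_def power_mult_distrib prod.distrib)
    qed
  qed measurable
  also have "(LINT z|torus_measure. f (r *\<^sub>R z) * (\<Prod>i\<in>UNIV. 1 / (1 - w $ i * cnj (z $ i)))) = f (r *\<^sub>R w)"
    by (rule torus_Cauchy_kernel[OF f r w])
  also have "(\<lambda>k. LINT z|torus_measure. f (r *\<^sub>R z) * (zpow k w * cnj (zpow k z))) =
      (\<lambda>k. (LINT z|torus_measure. f (r *\<^sub>R z) * cnj (zpow k z)) * zpow k w)"
    by (subst integral_mult_left_zero[symmetric]) (simp add: mult_ac)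
  finally show ?thesis .
qed

lemma Fourier_coefficient_of_series:
  fixes F :: "complex ^ 'n \<Rightarrow> complex"
  assumes [measurable]: "F \<in> borel_measurable borel" and c: "c abs_summable_on UNIV"
    and F: "\<And>z. (\<And>i. norm (z $ i) = 1) \<Longrightarrow> ((\<lambda>k. c k * zpow k z) has_sum F z) UNIV"
  shows "(LINT z|torus_measure. F z * cnj (zpow l z)) = c l"
proof -
  interpret prob_space "torus_measure :: (complex ^ 'n) measure" by (rule prob_space_torus_measure)
  have "((\<lambda>k. LINT z|torus_measure. c k * (zpow k z * cnj (zpow l z))) has_sum
      (LINT z|torus_measure. F z * cnj (zpow l z))) UNIV"
  proof (rule has_sum_integral[OF _ _ c])
    show "AE z in torus_measure. \<forall>k. norm (c k * (zpow k z * cnj (zpow l z))) \<le> norm (c k)"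
      using AE_torus_measure by eventually_elim (auto simp: norm_mult norm_zpow_torus)
    show "AE z in torus_measure. ((\<lambda>k. c k * (zpow k z * cnj (zpow l z)))
        has_sum (F z * cnj (zpow l z))) UNIV"
      using AE_torus_measure
    proof eventually_elim
      case (elim z)
      thus ?case using has_sum_cmult_left[OF F[of z], of "cnj (zpow l z)"] by (simp add: mult_ac)
    qed
  qed measurable
  also have "(\<lambda>k. LINT z|torus_measure. c k * (zpow k z * cnj (zpow l z))) = (\<lambda>k. if k = l then c l else 0)"
    by (rule ext) (simp add: zpow_orthonormal)
  finally have 1: "((\<lambda>k. if k = l then c l else 0) has_sum
      (LINT z|torus_measure. F z * cnj (zpow l z))) UNIV" .
  have "((\<lambda>k. if k = l then c l else 0) has_sum c l) UNIV"
    by (rule has_sum_finite_neutralI[of "{l}"]) auto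
  with 1 show ?thesis by (rule has_sum_unique)
qed

lemma series_summable_scaled:
  fixes f :: "complex ^ 'n \<Rightarrow> complex"
  assumes "\<And>z. z \<in> polydisc \<Longrightarrow> ((\<lambda>k. c k * zpow k z) has_sum f z) UNIV" "0 \<le> r" "r < 1"
  shows "(\<lambda>k. c k * of_real r ^ tdeg k) abs_summable_on UNIV"
proof -
  have "(\<chi> i. of_real r) \<in> (polydisc :: (complex ^ 'n) set)" using assms by (simp add: polydisc_def)
  from has_sum_imp_summable[OF assms(1)[OF this]] show ?thesis
    by (simp only: summable_on_iff_abs_summable_on_complex zpow_const)
qed

section \<open>Taylor coefficients\<close>

text \<open>The Taylor coefficients, computed on the torus of radius 1/2; by \<open>Fourier_coefficient\<close> below
any other radius below 1 gives the same numbers.\<close>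

definition coef :: "(complex ^ 'n \<Rightarrow> complex) \<Rightarrow> ('n \<Rightarrow> nat) \<Rightarrow> complex" where
  "coef f k = (LINT z|torus_measure. f ((1/2) *\<^sub>R z) * cnj (zpow k z)) * 2 ^ tdeg k"

text \<open>The radii \<open>r\<close> and 1/2 are both compared with a larger radius \<open>R\<close>: on smaller tori the
series that represents $f(R w)$ converges absolutely, and its Fourier coefficients can be read off.\<close>

lemma Fourier_coefficient:
  fixes f :: "complex ^ 'n \<Rightarrow> complex"
  assumes f: "f \<in> analytic0" and r: "0 \<le> r" "r < 1"
  shows "(LINT z|torus_measure. f (r *\<^sub>R z) * cnj (zpow k z)) = coef f k * of_real r ^ tdeg k"
proof -
  note f[THEN analytic0_measurable, measurable]
  define R where "R = (1 + max r (1/2)) / 2"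
  have R: "r < R" "1/2 < R" "R < 1" using r by (auto simp: R_def field_simps max_def)
  define a where "a = (\<lambda>k. LINT z|torus_measure. f (R *\<^sub>R z) * cnj (zpow k z))"
  have a: "((\<lambda>k. a k * zpow k w) has_sum f (R *\<^sub>R w)) UNIV" if "w \<in> polydisc" for w
    unfolding a_def using Taylor_scaled[OF f _ _ that] R by simp
  have *: "(LINT z|torus_measure. f (s *\<^sub>R z) * cnj (zpow k z)) = a k * of_real (s / R) ^ tdeg k"
    if s: "0 \<le> s" "s < R" for s
  proof (rule Fourier_coefficient_of_series)
    show "(\<lambda>k. a k * of_real (s / R) ^ tdeg k) abs_summable_on UNIV"
      using s R by (intro series_summable_scaled[OF a]) auto
    fix z :: "complex ^ 'n" assume "\<And>i. norm (z $ i) = 1"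
    hence "(s / R) *\<^sub>R z \<in> polydisc" using s R by (intro scaleR_in_polydisc) auto
    from a[OF this] show "((\<lambda>k. a k * of_real (s / R) ^ tdeg k * zpow k z) has_sum f (s *\<^sub>R z)) UNIV"
      using R by (simp add: zpow_scaleR mult_ac)
  qed measurable
  have half: "(LINT z|torus_measure. f ((1/2) *\<^sub>R z) * cnj (zpow k z)) = a k * of_real (1 / 2 / R) ^ tdeg k"
    using R by (intro *) auto
  have "of_real (1 / 2 / R) * 2 * of_real r = (of_real (r / R) :: complex)"
    by simp
  hence "of_real (r / R) ^ tdeg k = of_real (1 / 2 / R) ^ tdeg k * 2 ^ tdeg k
      * (of_real r :: complex) ^ tdeg k"
    by (simp only: power_mult_distrib[symmetric])
  thus ?thesis unfolding coef_def half *[OF r(1) R(1)] by (simp only: mult.assoc)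
qed

lemma Taylor_polydisc:
  fixes f :: "complex ^ 'n \<Rightarrow> complex"
  assumes f: "f \<in> analytic0" and z: "z \<in> polydisc"
  shows "((\<lambda>k. coef f k * zpow k z) has_sum f z) UNIV"
proof -
  define m where "m = Max (insert 0 (range (\<lambda>i. norm (z $ i))))"
  have m: "norm (z $ i) \<le> m" for i unfolding m_def by (intro Max_ge) auto
  have m1: "0 \<le> m" "m < 1" using z unfolding m_def by (auto simp: polydisc_def)
  define r where "r = (1 + m) / 2"
  have r: "m < r" "0 < r" "r < 1" using m1 by (auto simp: r_def)
  have "(1 / r) *\<^sub>R z \<in> polydisc"
    unfolding polydisc_def
  proof safe
    fix i
    have "norm (z $ i) < r" using m[of i] r by linarith
    thus "norm (((1 / r) *\<^sub>R z) $ i) < 1" using r by (simp add: field_simps)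
  qed
  \<comment> \<open>Rescaling to a radius between the largest $|z_i|$ and 1 makes the scaled expansion applicable.\<close>
  from Taylor_scaled[OF f _ r(3) this] r
  have "((\<lambda>k. coef f k * of_real r ^ tdeg k * zpow k ((1/r) *\<^sub>R z)) has_sum f z) UNIV"
    by (simp add: Fourier_coefficient[OF f])
  also have "(\<lambda>k. coef f k * of_real r ^ tdeg k * zpow k ((1/r) *\<^sub>R z)) = (\<lambda>k. coef f k * zpow k z)"
    using r by (intro ext) (simp add: zpow_scaleR power_divide)
  finally show ?thesis .
qed

lemma coef_unique:
  fixes f :: "complex ^ 'n \<Rightarrow> complex"
  assumes f: "f \<in> analytic0" and c: "\<And>z. z \<in> polydisc \<Longrightarrow> ((\<lambda>k. c k * zpow k z) has_sum f z) UNIV"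
  shows "coef f = c"
proof
  fix k
  note f[THEN analytic0_measurable, measurable]
  have "(LINT z|torus_measure. f ((1/2) *\<^sub>R z) * cnj (zpow k z)) = c k * of_real (1/2) ^ tdeg k"
  proof (rule Fourier_coefficient_of_series)
    show "(\<lambda>k. c k * of_real (1/2) ^ tdeg k) abs_summable_on UNIV"
      by (rule series_summable_scaled[OF c]) auto
    fix z :: "complex ^ 'n" assume "\<And>i. norm (z $ i) = 1"
    hence "(1/2) *\<^sub>R z \<in> polydisc" by (intro scaleR_in_polydisc) auto
    from c[OF this] show "((\<lambda>k. c k * of_real (1/2) ^ tdeg k * zpow k z) has_sum f ((1/2) *\<^sub>R z)) UNIV"
      by (simp add: zpow_scaleR mult_ac)
  qed measurable
  thus "coef f k = c k" unfolding coef_def by (simp add: power_divide)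
qed

lemma analytic0_eqI:
  assumes "f \<in> analytic0" "g \<in> analytic0" "coef f = coef g"
  shows "f = g"
proof
  fix z
  show "f z = g z"
  proof (cases "z \<in> polydisc")
    case True
    thus ?thesis using Taylor_polydisc[OF assms(1) True] Taylor_polydisc[OF assms(2) True] assms(3)
      by (simp add: has_sum_unique)
  qed (use assms in \<open>auto simp: analytic0_def\<close>)
qed

text \<open>Expand \<open>f\<close> only; the integral of a monomial against the conjugate of \<open>g\<close> is a Fourier
coefficient of \<open>g\<close>.\<close>

lemma Parseval_scaled:
  fixes f g :: "complex ^ 'n \<Rightarrow> complex"
  assumes f: "f \<in> analytic0" and g: "g \<in> analytic0" and r: "0 \<le> r" "r < 1"
  shows "((\<lambda>k. coef f k * cnj (coef g k) * of_real (r\<^sup>2) ^ tdeg k) has_sum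
      (LINT z|torus_measure. f (r *\<^sub>R z) * cnj (g (r *\<^sub>R z)))) UNIV"
proof -
  interpret prob_space "torus_measure :: (complex ^ 'n) measure" by (rule prob_space_torus_measure)
  note f[THEN analytic0_measurable, measurable] g[THEN analytic0_measurable, measurable]
  obtain B where B: "0 \<le> B" "\<And>z. (\<And>i. norm (z $ i) \<le> 1) \<Longrightarrow> norm (g (r *\<^sub>R z)) \<le> B"
    using analytic0_bounded[OF g r] by blast
  let ?c = "\<lambda>k. coef f k * of_real r ^ tdeg k"
  have "((\<lambda>k. LINT z|torus_measure. ?c k * (zpow k z * cnj (g (r *\<^sub>R z)))) has_sum
      (LINT z|torus_measure. f (r *\<^sub>R z) * cnj (g (r *\<^sub>R z)))) UNIV"
  proof (rule has_sum_integral)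
    show "(\<lambda>k. norm (?c k) * B) summable_on UNIV"
      using r by (intro summable_on_cmult_left series_summable_scaled[OF Taylor_polydisc[OF f]]) auto
    show "AE z in torus_measure. \<forall>k. norm (?c k * (zpow k z * cnj (g (r *\<^sub>R z)))) \<le> norm (?c k) * B"
      using AE_torus_measure
    proof eventually_elim
      case (elim z)
      have "norm (g (r *\<^sub>R z)) \<le> B" using elim by (intro B) auto
      thus ?case using elim by (auto simp: norm_mult norm_zpow_torus intro!: mult_left_mono)
    qed
    show "AE z in torus_measure. ((\<lambda>k. ?c k * (zpow k z * cnj (g (r *\<^sub>R z)))) has_sum
        (f (r *\<^sub>R z) * cnj (g (r *\<^sub>R z)))) UNIV"
      using AE_torus_measure
    proof eventually_elim
      case (elim z)
      hence "r *\<^sub>R z \<in> polydisc" using r by (intro scaleR_in_polydisc) auto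
      from has_sum_cmult_left[OF Taylor_polydisc[OF f this], of "cnj (g (r *\<^sub>R z))"]
      show ?case by (simp add: zpow_scaleR mult_ac)
    qed
  qed measurable
  also have "(\<lambda>k. LINT z|torus_measure. ?c k * (zpow k z * cnj (g (r *\<^sub>R z)))) =
     (\<lambda>k. coef f k * cnj (coef g k) * of_real (r\<^sup>2) ^ tdeg k)"
  proof
    fix k
    have "(LINT z|torus_measure. ?c k * (zpow k z * cnj (g (r *\<^sub>R z)))) =
        ?c k * cnj (LINT z|torus_measure. g (r *\<^sub>R z) * cnj (zpow k z))"
      by (simp flip: Bochner_Integration.integral_cnj add: mult.commute)
    also have "\<dots> = coef f k * cnj (coef g k) * of_real (r\<^sup>2) ^ tdeg k"
      unfolding Fourier_coefficient[OF g r] by (simp add: power2_eq_square power_mult_distrib)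
    finally show "(LINT z|torus_measure. ?c k * (zpow k z * cnj (g (r *\<^sub>R z)))) = coef f k
        * cnj (coef g k) * of_real (r\<^sup>2) ^ tdeg k" .
  qed
  finally show ?thesis .
qed

section \<open>Analytic functions defined by power series\<close>

text \<open>The value 0 off the polydisc is the normalization of \<^const>\<open>analytic0\<close>.\<close>

definition power_series :: "(('n \<Rightarrow> nat) \<Rightarrow> complex) \<Rightarrow> complex ^ 'n \<Rightarrow> complex" where
  "power_series a z = (if z \<in> polydisc then (\<Sum>\<^sub>\<infinity>k. a k * zpow k z) else 0)"

definition zpow_deriv :: "('n \<Rightarrow> nat) \<Rightarrow> complex ^ 'n \<Rightarrow> complex ^ 'n \<Rightarrow> complex" where
  "zpow_deriv k z h = (\<Sum>i\<in>UNIV. of_nat (k i) * h $ i * (z $ i) ^ (k i - 1)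
      * (\<Prod>j\<in>UNIV - {i}. (z $ j) ^ k j))"

lemma zpow_has_derivative: "(zpow k has_derivative zpow_deriv k z) (at z within S)"
proof -
  have "((\<lambda>z. (z $ i) ^ k i) has_derivative (\<lambda>h. of_nat (k i) * h $ i * (z $ i) ^ (k i - 1)))
      (at z within S)" for i
    using bounded_linear_imp_has_derivative[OF bounded_linear_vec_nth]
    by (auto intro!: derivative_eq_intros)
  from has_derivative_prod[of UNIV, OF this] show ?thesis
    by (simp add: zpow_def[abs_def] zpow_deriv_def[abs_def])
qed

lemma zpow_deriv_scale: "zpow_deriv k z (c *s h) = c * zpow_deriv k z h"
  by (simp add: zpow_deriv_def sum_distrib_left mult_ac)

lemma norm_zpow_deriv_le:
  assumes "\<And>i. norm (z $ i) \<le> s" "0 < s"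
  shows "norm (zpow_deriv k z h) \<le> real (tdeg k) * s ^ tdeg k / s * norm h"
proof -
  have "norm (of_nat (k i) * h $ i * (z $ i) ^ (k i - 1) * (\<Prod>j\<in>UNIV - {i}. (z $ j) ^ k j))
      \<le> real (k i) * (s ^ tdeg k / s * norm h)" for i
  proof (cases "k i = 0")
    case False
    have "norm (\<Prod>j\<in>UNIV - {i}. (z $ j) ^ k j) \<le> (\<Prod>j\<in>UNIV - {i}. s ^ k j)"
      unfolding prod_norm[symmetric] norm_power using assms by (intro prod_mono) (auto intro: power_mono)
    moreover have "norm ((z $ i) ^ (k i - 1)) \<le> s ^ (k i - 1)"
      unfolding norm_power using assms by (intro power_mono) auto
    ultimately have "norm (of_nat (k i) * h $ i * (z $ i) ^ (k i - 1) * (\<Prod>j\<in>UNIV - {i}. (z $ j) ^ k j))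
        \<le> real (k i) * norm h * s ^ (k i - 1) * (\<Prod>j\<in>UNIV - {i}. s ^ k j)"
      unfolding norm_mult norm_of_nat using assms Finite_Cartesian_Product.norm_nth_le[of h i]
      by (intro mult_mono mult_nonneg_nonneg) auto
    also have "s ^ tdeg k = s ^ k i * (\<Prod>j\<in>UNIV - {i}. s ^ k j)"
      unfolding tdeg_def power_sum by (rule prod.remove) auto
    hence "real (k i) * norm h * s ^ (k i - 1) * (\<Prod>j\<in>UNIV - {i}. s ^ k j) = real (k i)
        * (s ^ tdeg k / s * norm h)"
      using assms False by (simp add: power_eq_if)
    finally show ?thesis .
  qed simp
  hence "norm (zpow_deriv k z h) \<le> (\<Sum>i\<in>UNIV. real (k i) * (s ^ tdeg k / s * norm h))"
    unfolding zpow_deriv_def by (intro sum_norm_le) auto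
  also have "\<dots> = real (tdeg k) * (s ^ tdeg k / s * norm h)"
    by (simp only: sum_distrib_right[symmetric] of_nat_sum tdeg_def)
  finally show ?thesis by simp
qed

text \<open>If $s < t < 1$, then $n s^n \le K t^n$ because $n (s/t)^n$ tends to 0.\<close>

lemma summable_tdeg_power:
  assumes "0 < s" "s < 1"
  shows "(\<lambda>k::'n::finite \<Rightarrow> nat. real (tdeg k) * s ^ tdeg k) summable_on UNIV"
proof -
  define t where "t = (1 + s) / 2"
  have t: "s < t" "0 < t" "t < 1" using assms by (auto simp: t_def)
  have "(\<lambda>n. of_nat n * (s / t) ^ n) \<longlonglongrightarrow> 0"
    using t assms by (intro powser_times_n_limit_0) auto
  then obtain K where K: "\<And>n. norm (of_nat n * (s / t) ^ n) \<le> K"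
    using convergentI Bseq_def convergent_imp_Bseq by metis
  have le: "real n * s ^ n \<le> K * t ^ n" for n
    using K[of n] t assms by (simp add: power_divide field_simps abs_mult)
  show ?thesis
  proof (rule summable_on_comparison_test)
    show "(\<lambda>k::'n \<Rightarrow> nat. K * t ^ tdeg k) summable_on UNIV"
      using t by (intro summable_on_cmult_right summable_power_tdeg) auto
  qed (use le assms in auto)
qed

lemma zpow_series_summable:
  fixes a :: "('n::finite \<Rightarrow> nat) \<Rightarrow> complex"
  assumes a: "\<And>k. norm (a k) \<le> C" and z: "z \<in> polydisc"
  shows "(\<lambda>k. a k * zpow k z) summable_on UNIV"
proof (rule abs_summable_summable)
  have C: "0 \<le> C" using a[of undefined] norm_ge_zero order_trans by blast
  show "(\<lambda>k. a k * zpow k z) abs_summable_on UNIV"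
  proof (rule summable_on_comparison_test)
    show "(\<lambda>k. C * norm (zpow k z)) summable_on UNIV"
      using geometric_has_sum(2)[of "\<lambda>i. z $ i"] z
      by (intro summable_on_cmult_right) (simp add: zpow_def polydisc_def)
  qed (auto simp: norm_mult intro!: mult_right_mono a)
qed

lemma power_series_has_sum:
  assumes "\<And>k. norm (a k) \<le> C" "z \<in> polydisc"
  shows "((\<lambda>k. a k * zpow k z) has_sum power_series a z) UNIV"
  using zpow_series_summable[OF assms] assms(2) by (simp add: power_series_def)

text \<open>On a smaller polydisc the differentiated series is dominated by a convergent one, so the series
can be differentiated termwise, and a sum of complex linear maps is complex linear.\<close>

lemma power_series_analytic0:
  fixes a :: "('n::finite \<Rightarrow> nat) \<Rightarrow> complex"
  assumes a: "\<And>k. norm (a k) \<le> C"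
  shows "power_series a \<in> analytic0"
proof -
  have C: "0 \<le> C" using a[of undefined] norm_ge_zero order_trans by blast
  have "range (\<lambda>m (_::'n). m::nat) \<subseteq> UNIV" by simp
  moreover have "infinite (range (\<lambda>m (_::'n). m::nat))"
    by (intro range_inj_infinite injI) (auto dest: fun_cong)
  ultimately have inf: "infinite (UNIV :: ('n \<Rightarrow> nat) set)" by (metis finite_subset)
  \<comment> \<open>The theorem on differentiating series speaks about sequences, so the multi-indices are enumerated.\<close>
  then obtain e :: "nat \<Rightarrow> 'n \<Rightarrow> nat" where e: "bij e"
    using bij_betw_from_nat_into[of "UNIV :: ('n \<Rightarrow> nat) set"] by auto
  have "\<exists>f'. (power_series a has_derivative f') (at z) \<and> (\<forall>c v. f' (c *s v) = c * f' v)"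
    if z: "z \<in> polydisc" for z
  proof -
    define m where "m = Max (insert 0 (range (\<lambda>i. norm (z $ i))))"
    have m: "norm (z $ i) \<le> m" for i unfolding m_def by (intro Max_ge) auto
    have m1: "0 \<le> m" "m < 1" using z unfolding m_def by (auto simp: polydisc_def)
    \<comment> \<open>The radius of a polydisc \<open>S\<close> around 0 that contains \<open>z\<close> and has compact closure in the unit
        polydisc.\<close>
    define s where "s = (1 + m) / 2"
    have s: "m < s" "0 < s" "s < 1" using m1 by (auto simp: s_def)
    define S :: "(complex ^ 'n) set" where "S = {x. \<forall>i. norm (x $ i) < s}"
    have S_eq: "S = (\<Inter>i. {x. norm (x $ i) < s})" by (auto simp: S_def)
    have zS: "z \<in> S" using m s unfolding S_def by (auto intro: le_less_trans)
    have "open S"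
      unfolding S_eq by (intro open_INT ballI open_Collect_less continuous_intros finite)
    have "convex {x :: complex ^ 'n. norm (x $ i) < s}" for i
    proof -
      have "{x :: complex ^ 'n. norm (x $ i) < s} = (\<lambda>x. x $ i) -` ball 0 s" by auto
      thus ?thesis by (simp add: convex_linear_vimage bounded_linear.linear[OF bounded_linear_vec_nth])
    qed
    hence "convex S" unfolding S_eq by (intro convex_INT) auto
    have SD: "x \<in> polydisc" if "x \<in> S" for x
      using that s by (auto simp: S_def polydisc_def intro: less_trans)
    define M where "M = (\<lambda>i. C * (real (tdeg (e i)) * s ^ tdeg (e i) / s))"
    have Msum: "M summable_on UNIV"
    proof -
      have "(\<lambda>k::'n \<Rightarrow> nat. C * (real (tdeg k) * s ^ tdeg k * (1 / s))) summable_on UNIV"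
        using s by (intro summable_on_cmult_right summable_on_cmult_left summable_tdeg_power) auto
      hence "(\<lambda>i. C * (real (tdeg (e i)) * s ^ tdeg (e i) * (1 / s))) summable_on UNIV"
        by (subst summable_on_reindex_bij_betw[OF e, of "\<lambda>k. C * (real (tdeg k) * s ^ tdeg k * (1 / s))"])
      thus ?thesis by (simp add: M_def)
    qed
    define f' where "f' = (\<lambda>i x h. a (e i) * zpow_deriv (e i) x h)"
    define g' where "g' = (\<lambda>x h. \<Sum>\<^sub>\<infinity>i. f' i x h)"
    have bound: "norm (f' i x h) \<le> M i * norm h" if "x \<in> S" for i x h
    proof -
      have "norm (zpow_deriv (e i) x h) \<le> real (tdeg (e i)) * s ^ tdeg (e i) / s * norm h"
        using that s by (intro norm_zpow_deriv_le) (auto simp: S_def less_imp_le)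
      thus ?thesis unfolding f'_def M_def norm_mult mult.assoc[of C]
        using C by (intro mult_mono a) auto
    qed
    have g'_sum: "((\<lambda>i. f' i x h) has_sum g' x h) UNIV" if "x \<in> S" for x h
      unfolding g'_def
    proof (rule has_sum_infsum, rule abs_summable_summable, rule summable_on_comparison_test)
      show "(\<lambda>i. M i * norm h) summable_on UNIV" using Msum by (rule summable_on_cmult_left)
    qed (use bound[OF that] in auto)
    have sums: "(\<lambda>i. a (e i) * zpow (e i) x) sums power_series a x" if "x \<in> S" for x
      using power_series_has_sum[OF a SD[OF that]]
      by (intro has_sum_imp_sums) (subst has_sum_reindex_bij_betw[OF e, of "\<lambda>k. a k * zpow k x"])
    have "\<exists>g. \<forall>x\<in>S. (\<lambda>i. a (e i) * zpow (e i) x) sums g x \<and> (g has_derivative g' x) (at x within S)"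
    proof (rule has_derivative_series[where f = "\<lambda>i x. a (e i) * zpow (e i) x" and f' = f' and g' = g',
          OF \<open>convex S\<close> _ _ zS sums[OF zS]])
      show "((\<lambda>z. a (e n) * zpow (e n) z) has_derivative f' n x) (at x within S)" for n x
        unfolding f'_def by (intro has_derivative_mult_right zpow_has_derivative)
      fix \<epsilon> :: real assume "0 < \<epsilon>"
      have "(\<lambda>n. infsum M UNIV - sum M {..<n}) \<longlonglongrightarrow> infsum M UNIV - infsum M UNIV"
        using has_sum_imp_sums[OF has_sum_infsum[OF Msum]]
        by (intro tendsto_intros) (simp add: sums_def)
      hence "\<forall>\<^sub>F n in sequentially. infsum M UNIV - sum M {..<n} < \<epsilon>"
        using \<open>0 < \<epsilon>\<close> by (auto dest: order_tendstoD)
      thus "\<forall>\<^sub>F n in sequentially. \<forall>x\<in>S. \<forall>h. norm ((\<Sum>i<n. f' i x h) - g' x h) \<le> \<epsilon> * norm h"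
      proof eventually_elim
        case (elim n)
        show ?case
        proof (intro ballI allI)
          fix x h assume x: "x \<in> S"
          have "norm ((\<Sum>i<n. f' i x h) - g' x h) \<le>
              infsum (\<lambda>i. M i * norm h) UNIV - (\<Sum>i<n. M i * norm h)"
            using Msum by (intro has_sum_tail_bound[OF g'_sum[OF x]] bound x summable_on_cmult_left) auto
          also have "\<dots> = (infsum M UNIV - sum M {..<n}) * norm h"
            by (simp add: infsum_cmult_left' sum_distrib_right left_diff_distrib)
          also have "\<dots> \<le> \<epsilon> * norm h" using elim by (intro mult_right_mono) auto
          finally show "norm ((\<Sum>i<n. f' i x h) - g' x h) \<le> \<epsilon> * norm h" .
        qed
      qed
    qed
    then obtain g where g: "\<And>x. x \<in> S \<Longrightarrow> (\<lambda>i. a (e i) * zpow (e i) x) sums g x"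
      "\<And>x. x \<in> S \<Longrightarrow> (g has_derivative g' x) (at x within S)" by blast
    have g_eq: "g x = power_series a x" if "x \<in> S" for x
      using g(1)[OF that] sums[OF that] by (rule sums_unique2)
    have "(g has_derivative g' z) (at z)"
      using g(2)[OF zS] at_within_open[OF zS \<open>open S\<close>] by simp
    hence "(power_series a has_derivative g' z) (at z)"
      by (rule has_derivative_transform_within_open[OF _ \<open>open S\<close> zS g_eq])
    moreover have "g' z (c *s v) = c * g' z v" for c v
      unfolding g'_def f'_def zpow_deriv_scale
      by (simp add: mult.left_commute[of _ c] infsum_cmult_right')
    ultimately show ?thesis by blast
  qed
  thus ?thesis by (auto simp: analytic0_def analytic_on_polydisc_def power_series_def)
qed

lemma coef_power_series:
  assumes "\<And>k. norm (a k) \<le> C"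
  shows "coef (power_series a) = a"
  using power_series_analytic0[OF assms] power_series_has_sum[OF assms]
  by (rule coef_unique)

section \<open>Algebraic operations\<close>

lemma analytic0_mult:
  assumes \<phi>: "\<phi> \<in> H_infinity" and f: "f \<in> analytic0"
  shows "(\<lambda>z. \<phi> z * f z) \<in> analytic0"
proof -
  have "\<exists>h'. ((\<lambda>z. \<phi> z * f z) has_derivative h') (at z) \<and> (\<forall>c v. h' (c *s v) = c * h' v)"
    if z: "z \<in> polydisc" for z
  proof -
    obtain p' where "(\<phi> has_derivative p') (at z)" "\<forall>c v. p' (c *s v) = c * p' v"
      using \<phi> z unfolding H_infinity_def analytic_on_polydisc_def by blast
    moreover obtain f' where "(f has_derivative f') (at z)" "\<forall>c v. f' (c *s v) = c * f' v"
      using f z unfolding analytic0_def analytic_on_polydisc_def by blast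
    ultimately show ?thesis
      by (intro exI[of _ "\<lambda>h. \<phi> z * f' h + p' h * f z"] conjI has_derivative_mult)
         (auto simp: algebra_simps)
  qed
  thus ?thesis using f by (auto simp: analytic0_def analytic_on_polydisc_def)
qed

lemma analytic0_sum:
  fixes f :: "'j \<Rightarrow> complex ^ 'n \<Rightarrow> complex"
  assumes "\<And>j. j \<in> J \<Longrightarrow> f j \<in> analytic0"
  shows "(\<lambda>z. \<Sum>j\<in>J. c j * f j z) \<in> analytic0"
proof -
  have "\<exists>h'. ((\<lambda>z. \<Sum>j\<in>J. c j * f j z) has_derivative h') (at z) \<and> (\<forall>b v. h' (b *s v) = b * h' v)"
    if z: "z \<in> polydisc" for z
  proof -
    have "\<exists>f'. \<forall>j\<in>J. (f j has_derivative f' j) (at z) \<and> (\<forall>b v. f' j (b *s v) = b * f' j v)"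
      using assms z by (intro bchoice) (auto simp: analytic0_def analytic_on_polydisc_def)
    then obtain f' where "\<And>j. j \<in> J \<Longrightarrow> (f j has_derivative f' j) (at z)"
       "\<And>j b v. j \<in> J \<Longrightarrow> f' j (b *s v) = b * f' j v" by blast
    thus ?thesis
      by (intro exI[of _ "\<lambda>h. \<Sum>j\<in>J. c j * f' j h"] conjI has_derivative_sum has_derivative_mult_right)
         (auto simp: sum_distrib_left mult.left_commute)
  qed
  thus ?thesis using assms by (auto simp: analytic0_def analytic_on_polydisc_def intro!: sum.neutral)
qed

lemma has_sum_finite_combination:
  fixes a :: "'j \<Rightarrow> 'k \<Rightarrow> complex"
  assumes "finite J" "\<And>j. j \<in> J \<Longrightarrow> (a j has_sum s j) A"
  shows "((\<lambda>k. \<Sum>j\<in>J. c j * a j k) has_sum (\<Sum>j\<in>J. c j * s j)) A"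
  using assms by (induction J rule: finite_induct) (auto intro!: has_sum_add has_sum_cmult_right)

lemma coef_sum:
  fixes f :: "'j \<Rightarrow> complex ^ 'n \<Rightarrow> complex"
  assumes J: "finite J" and f: "\<And>j. j \<in> J \<Longrightarrow> f j \<in> analytic0"
  shows "coef (\<lambda>z. \<Sum>j\<in>J. c j * f j z) k = (\<Sum>j\<in>J. c j * coef (f j) k)"
proof -
  have "coef (\<lambda>z. \<Sum>j\<in>J. c j * f j z) = (\<lambda>k. \<Sum>j\<in>J. c j * coef (f j) k)"
  proof (rule coef_unique[OF analytic0_sum[OF f]])
    fix z :: "complex ^ 'n" assume "z \<in> polydisc"
    from has_sum_finite_combination[where c = c, OF J Taylor_polydisc[OF f this]]
    show "((\<lambda>k. (\<Sum>j\<in>J. c j * coef (f j) k) * zpow k z) has_sum (\<Sum>j\<in>J. c j * f j z)) UNIV"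
      by (simp add: sum_distrib_right mult.assoc)
  qed
  thus ?thesis by simp
qed

lemma analytic0_diff: "f \<in> analytic0 \<Longrightarrow> g \<in> analytic0 \<Longrightarrow> (\<lambda>z. f z - g z) \<in> analytic0"
  using analytic0_sum[of "{False, True}" "\<lambda>b. if b then f else g" "\<lambda>b. if b then 1 else -1"] by simp

lemma coef_diff: "f \<in> analytic0 \<Longrightarrow> g \<in> analytic0 \<Longrightarrow> coef (\<lambda>z. f z - g z) k = coef f k - coef g k"
  using coef_sum[of "{False, True}" "\<lambda>b. if b then f else g" "\<lambda>b. if b then 1 else -1"] by simp

section \<open>The Hardy space in coefficients\<close>

text \<open>The series converges uniformly for $r$ in $[0, 1]$, so its sum is continuous at 1.\<close>

lemma Abel_limit:
  fixes c :: "('n::finite \<Rightarrow> nat) \<Rightarrow> 'b::{banach, real_normed_field}"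
  assumes c: "c abs_summable_on UNIV"
  shows "((\<lambda>r. \<Sum>\<^sub>\<infinity>k. c k * of_real (r\<^sup>2) ^ tdeg k) \<longlongrightarrow> (\<Sum>\<^sub>\<infinity>k. c k)) (at_left 1)"
proof -
  let ?h = "\<lambda>r::real. \<Sum>\<^sub>\<infinity>k. c k * of_real (r\<^sup>2) ^ tdeg k"
  have "uniform_limit {0..1} (\<lambda>F r. \<Sum>k\<in>F. c k * of_real (r\<^sup>2) ^ tdeg k) ?h (finite_subsets_at_top UNIV)"
  proof (rule Weierstrass_m_test_general[OF _ c])
    fix k :: "'n \<Rightarrow> nat" and r :: real assume "r \<in> {0..1}"
    hence "(r\<^sup>2) ^ tdeg k \<le> 1" by (intro power_le_one) auto
    thus "norm (c k * of_real (r\<^sup>2) ^ tdeg k) \<le> norm (c k)"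
      unfolding norm_mult norm_power norm_of_real by (simp add: mult_left_le)
  qed
  hence "continuous_on {0..1} ?h"
    by (rule uniform_limit_theorem[rotated]) (auto intro!: always_eventually continuous_intros)
  hence "(?h \<longlongrightarrow> ?h 1) (at 1 within {0..1})"
    unfolding continuous_on_def by (rule bspec) simp
  moreover have "at 1 within {0..1::real} = at_left 1"
    by (rule at_within_Icc_at_left) simp
  moreover have "?h 1 = (\<Sum>\<^sub>\<infinity>k. c k)" by simp
  ultimately show ?thesis by (simp only:)
qed

lemma square_mean_has_sum:
  fixes f :: "complex ^ 'n \<Rightarrow> complex"
  assumes f: "f \<in> analytic0" and r: "0 \<le> r" "r < 1"
  shows "((\<lambda>k. (norm (coef f k))\<^sup>2 * (r\<^sup>2) ^ tdeg k) has_sum square_mean f r) UNIV"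
proof -
  have "((\<lambda>k. complex_of_real ((norm (coef f k))\<^sup>2 * (r\<^sup>2) ^ tdeg k)) has_sum
      (LINT z|torus_measure. complex_of_real ((norm (f (r *\<^sub>R z)))\<^sup>2))) UNIV"
    using Parseval_scaled[OF f f r]
    unfolding of_real_mult complex_norm_square unfolding of_real_power .
  thus ?thesis
    unfolding square_mean_def integral_complex_of_real has_sum_of_real_iff .
qed

text \<open>Let $r$ tend to 1 in a finite part of the series for the square mean.\<close>

lemma sum_norm_coef_le:
  assumes f: "f \<in> analytic0" and le: "\<And>r. 0 \<le> r \<Longrightarrow> r < 1 \<Longrightarrow> square_mean f r \<le> B" and F: "finite F"
  shows "(\<Sum>k\<in>F. (norm (coef f k))\<^sup>2) \<le> B"
proof -
  have "((\<lambda>r. \<Sum>k\<in>F. (norm (coef f k))\<^sup>2 * (r\<^sup>2) ^ tdeg k)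
      \<longlongrightarrow> (\<Sum>k\<in>F. (norm (coef f k))\<^sup>2 * (1\<^sup>2) ^ tdeg k)) (at_left 1)"
    by (intro tendsto_intros)
  moreover have "\<forall>\<^sub>F r::real in at_left 1. 0 \<le> r \<and> r < 1"
    using eventually_at_left_real[of 0 1] by (auto elim!: eventually_mono)
  hence "\<forall>\<^sub>F r in at_left 1. (\<Sum>k\<in>F. (norm (coef f k))\<^sup>2 * (r\<^sup>2) ^ tdeg k) \<le> B"
  proof eventually_elim
    case (elim r)
    have "(\<Sum>k\<in>F. (norm (coef f k))\<^sup>2 * (r\<^sup>2) ^ tdeg k) \<le> square_mean f r"
      using F elim by (intro finite_sum_le_has_sum[OF square_mean_has_sum[OF f]]) auto
    thus ?case using le elim by fastforce
  qed
  ultimately have "(\<Sum>k\<in>F. (norm (coef f k))\<^sup>2 * (1\<^sup>2) ^ tdeg k) \<le> B"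
    by (rule tendsto_upperbound) simp
  thus ?thesis by simp
qed

lemma square_mean_le:
  fixes f :: "complex ^ 'n \<Rightarrow> complex"
  assumes f: "f \<in> analytic0" and s: "(\<lambda>k. (norm (coef f k))\<^sup>2) summable_on UNIV"
    and r: "0 \<le> r" "r < 1"
  shows "square_mean f r \<le> (\<Sum>\<^sub>\<infinity>k. (norm (coef f k))\<^sup>2)"
proof (rule has_sum_mono[OF square_mean_has_sum[OF f r] has_sum_infsum[OF s]])
  fix k :: "'n \<Rightarrow> nat"
  have "(r\<^sup>2) ^ tdeg k \<le> 1" using r by (intro power_le_one) (auto simp: power2_eq_square mult_le_one)
  thus "(norm (coef f k))\<^sup>2 * (r\<^sup>2) ^ tdeg k \<le> (norm (coef f k))\<^sup>2" by (simp add: mult_left_le)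
qed

text \<open>Both directions compare with the series of the square mean, whose terms increase to the squares of
the absolute values of the coefficients as the radius tends to 1.\<close>

lemma hardy2_iff:
  fixes f :: "complex ^ 'n \<Rightarrow> complex"
  shows
  "f \<in> hardy2 \<longleftrightarrow> f \<in> analytic0 \<and> (\<lambda>k. (norm (coef f k))\<^sup>2) summable_on UNIV"
proof (intro iffI conjI; (elim conjE)?)
  assume f: "f \<in> hardy2"
  thus f0: "f \<in> analytic0" by (auto simp: hardy2_def analytic0_def)
  obtain B where "\<forall>r\<in>{0..<1}. square_mean f r \<le> B"
    using f by (auto simp: hardy2_def bdd_above_def)
  hence B: "\<And>r. 0 \<le> r \<Longrightarrow> r < 1 \<Longrightarrow> square_mean f r \<le> B" by auto
  show "(\<lambda>k. (norm (coef f k))\<^sup>2) summable_on UNIV"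
    by (rule nonneg_bdd_above_summable_on) (auto intro!: bdd_aboveI sum_norm_coef_le[OF f0 B])
next
  assume f: "f \<in> analytic0" and s: "(\<lambda>k. (norm (coef f k))\<^sup>2) summable_on UNIV"
  have "square_mean f r \<le> (\<Sum>\<^sub>\<infinity>k. (norm (coef f k))\<^sup>2)" if "r \<in> {0..<1}" for r
    using that by (intro square_mean_le f s) auto
  hence "bdd_above (square_mean f ` {0..<1})" by (rule bdd_aboveI2)
  thus "f \<in> hardy2" using f by (auto simp: hardy2_def analytic0_def)
qed

lemma hardy2_analytic0: "f \<in> hardy2 \<Longrightarrow> f \<in> analytic0"
  by (simp add: hardy2_iff)

text \<open>The limit that defines the inner product exists, by Abel's theorem for the series of the products of
the coefficients; its value is the inner product of the two families.\<close>

lemma hardy_inner_tendsto: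
  fixes f g :: "complex ^ 'n \<Rightarrow> complex"
  assumes f: "f \<in> hardy2" and g: "g \<in> hardy2"
  shows "((\<lambda>r. LINT z|torus_measure. f (r *\<^sub>R z) * cnj (g (r *\<^sub>R z))) \<longlongrightarrow> hardy_inner f g) (at_left 1)"
    and "((\<lambda>k. coef f k * cnj (coef g k)) has_sum hardy_inner f g) UNIV"
    and "(\<lambda>k. coef f k * cnj (coef g k)) abs_summable_on UNIV"
proof -
  have "(\<lambda>k. complex_of_real (norm (coef f k)) * of_real (norm (coef g k))) abs_summable_on UNIV"
    by (rule abs_summable_product) (use f g in \<open>auto simp: hardy2_iff power2_eq_square norm_mult\<close>)
  thus abs: "(\<lambda>k. coef f k * cnj (coef g k)) abs_summable_on UNIV"
    by (simp add: norm_mult)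
  have "\<forall>\<^sub>F r::real in at_left 1. 0 \<le> r \<and> r < 1"
    using eventually_at_left_real[of 0 1] by (auto elim!: eventually_mono)
  hence "\<forall>\<^sub>F r in at_left 1. (\<Sum>\<^sub>\<infinity>k. coef f k * cnj (coef g k) * of_real (r\<^sup>2) ^ tdeg k) =
      (LINT z|torus_measure. f (r *\<^sub>R z) * cnj (g (r *\<^sub>R z)))"
    by eventually_elim (use f g in \<open>auto intro!: infsumI Parseval_scaled simp del: of_real_power simp:
        hardy2_analytic0\<close>)
  from Lim_transform_eventually[OF Abel_limit[OF abs] this]
  have lim: "((\<lambda>r. LINT z|torus_measure. f (r *\<^sub>R z) * cnj (g (r *\<^sub>R z)))
      \<longlongrightarrow> (\<Sum>\<^sub>\<infinity>k. coef f k * cnj (coef g k))) (at_left 1)" .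
  hence eq: "hardy_inner f g = (\<Sum>\<^sub>\<infinity>k. coef f k * cnj (coef g k))"
    unfolding hardy_inner_def by (intro tendsto_Lim) auto
  show "((\<lambda>r. LINT z|torus_measure. f (r *\<^sub>R z) * cnj (g (r *\<^sub>R z))) \<longlongrightarrow> hardy_inner f g) (at_left 1)"
    using lim by (simp add: eq)
  show "((\<lambda>k. coef f k * cnj (coef g k)) has_sum hardy_inner f g) UNIV"
    unfolding eq by (rule has_sum_infsum[OF abs_summable_summable[OF abs]])
qed

lemma hardy_norm_le:
  assumes "f \<in> hardy2" "\<And>r. 0 \<le> r \<Longrightarrow> r < 1 \<Longrightarrow> square_mean f r \<le> B\<^sup>2" "0 \<le> B"
  shows "hardy_norm f \<le> B"
proof -
  have "(SUP r\<in>{0..<1}. square_mean f r) \<le> B\<^sup>2"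
    using assms by (intro cSUP_least) auto
  thus ?thesis unfolding hardy_norm_def using assms(3) by (simp add: real_le_lsqrt)
qed

lemma hardy_norm_nonneg: "f \<in> hardy2 \<Longrightarrow> 0 \<le> hardy_norm f"
proof -
  assume f: "f \<in> hardy2"
  have "0 \<le> square_mean f 0"
    by (rule has_sum_nonneg[OF square_mean_has_sum[OF hardy2_analytic0[OF f]]]) auto
  also have "\<dots> \<le> (SUP r\<in>{0..<1}. square_mean f r)"
    using f by (intro cSUP_upper) (auto simp: hardy2_def)
  finally show ?thesis by (simp add: hardy_norm_def)
qed

lemma hardy_norm_has_sum:
  fixes f :: "complex ^ 'n \<Rightarrow> complex"
  assumes f: "f \<in> hardy2"
  shows "((\<lambda>k. (norm (coef f k))\<^sup>2) has_sum (hardy_norm f)\<^sup>2) UNIV"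
proof -
  note f0 = hardy2_analytic0[OF f]
  have s: "(\<lambda>k. (norm (coef f k))\<^sup>2) summable_on UNIV" using f by (simp add: hardy2_iff)
  let ?S = "SUP r\<in>{0..<1}. square_mean f r"
  have bdd: "bdd_above (square_mean f ` {0..<1})" using f by (simp add: hardy2_def)
  have le: "square_mean f r \<le> ?S" if "0 \<le> r" "r < 1" for r
    using that by (intro cSUP_upper bdd) auto
  have "(\<Sum>\<^sub>\<infinity>k. (norm (coef f k))\<^sup>2) \<le> ?S"
    using s sum_norm_coef_le[OF f0 le] by (intro infsum_le_finite_sums) auto
  moreover have "?S \<le> (\<Sum>\<^sub>\<infinity>k. (norm (coef f k))\<^sup>2)"
    by (rule cSUP_least) (auto intro!: square_mean_le f0 s)
  ultimately have "?S = (\<Sum>\<^sub>\<infinity>k. (norm (coef f k))\<^sup>2)" by simp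
  thus ?thesis using hardy_norm_nonneg[OF f] s unfolding hardy_norm_def by simp
qed

lemma hardy_inner_self:
  assumes f: "f \<in> hardy2"
  shows "hardy_inner f f = of_real ((hardy_norm f)\<^sup>2)"
proof -
  have "((\<lambda>k. complex_of_real ((norm (coef f k))\<^sup>2)) has_sum of_real ((hardy_norm f)\<^sup>2)) UNIV"
    using hardy_norm_has_sum[OF f] by (simp only: has_sum_of_real_iff)
  hence "((\<lambda>k. coef f k * cnj (coef f k)) has_sum of_real ((hardy_norm f)\<^sup>2)) UNIV"
    by (simp only: complex_norm_square)
  with hardy_inner_tendsto(2)[OF f f] show ?thesis by (rule has_sum_unique)
qed

lemma hardy_inner_commute:
  assumes "f \<in> hardy2" "g \<in> hardy2"
  shows "hardy_inner g f = cnj (hardy_inner f g)"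
proof (rule has_sum_unique[OF hardy_inner_tendsto(2)[OF assms(2,1)]])
  show "((\<lambda>k. coef g k * cnj (coef f k)) has_sum cnj (hardy_inner f g)) UNIV"
    using has_sum_cnj_iff[THEN iffD2, OF hardy_inner_tendsto(2)[OF assms]] by (simp add: mult.commute)
qed

lemma hardy2_sum:
  fixes f :: "'j \<Rightarrow> complex ^ 'n \<Rightarrow> complex"
  assumes J: "finite J" and f: "\<And>j. j \<in> J \<Longrightarrow> f j \<in> hardy2"
  shows "(\<lambda>z. \<Sum>j\<in>J. c j * f j z) \<in> hardy2"
  using J f
proof (induction J rule: finite_induct)
  case empty
  have "(\<lambda>z. \<Sum>j\<in>({}::'j set). c j * f j z) \<in> analytic0" by (rule analytic0_sum) simp
  moreover have "coef (\<lambda>z::complex ^ 'n. \<Sum>j\<in>({}::'j set). c j * f j z) = (\<lambda>_. 0)"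
    using coef_sum[of "{}" f c] by auto
  ultimately show ?case by (simp add: hardy2_iff)
next
  case (insert j J)
  let ?g = "\<lambda>z. \<Sum>j\<in>J. c j * f j z"
  have g: "?g \<in> hardy2" using insert by auto
  have f0: "\<And>i. i \<in> insert j J \<Longrightarrow> f i \<in> analytic0" using insert.prems by (auto intro: hardy2_analytic0)
  have coef: "coef (\<lambda>z. \<Sum>i\<in>insert j J. c i * f i z) k = c j * coef (f j) k + coef ?g k" for k
    using insert.hyps f0 by (subst (1 2) coef_sum) auto
  have "(\<lambda>k. (norm (c j * coef (f j) k + coef ?g k))\<^sup>2) summable_on UNIV"
  proof (rule summable_on_comparison_test)
    show "(\<lambda>k. 2 * (norm (c j))\<^sup>2 * (norm (coef (f j) k))\<^sup>2 + 2 * (norm (coef ?g k))\<^sup>2) summable_on UNIV"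
      using g insert.prems by (intro summable_on_add summable_on_cmult_right) (auto simp: hardy2_iff)
    fix k :: "'n \<Rightarrow> nat"
    have "(norm (c j * coef (f j) k + coef ?g k))\<^sup>2 \<le> (norm (c j * coef (f j) k) + norm (coef ?g k))\<^sup>2"
      by (intro power_mono norm_triangle_ineq) auto
    also have "\<dots> \<le> 2 * (norm (c j * coef (f j) k))\<^sup>2 + 2 * (norm (coef ?g k))\<^sup>2"
      using sum_squares_bound[of "norm (c j * coef (f j) k)" "norm (coef ?g k)"] by (simp add: power2_sum)
    finally show "(norm (c j * coef (f j) k + coef ?g k))\<^sup>2 \<le>
        2 * (norm (c j))\<^sup>2 * (norm (coef (f j) k))\<^sup>2 + 2 * (norm (coef ?g k))\<^sup>2"
      by (simp add: norm_mult power_mult_distrib)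
  qed auto
  moreover have "(\<lambda>z. \<Sum>i\<in>insert j J. c i * f i z) \<in> analytic0"
    by (rule analytic0_sum) (rule f0)
  ultimately show ?case unfolding hardy2_iff coef by blast
qed

lemma hardy2_diff: "f \<in> hardy2 \<Longrightarrow> g \<in> hardy2 \<Longrightarrow> (\<lambda>z. f z - g z) \<in> hardy2"
  using hardy2_sum[of "{False, True}" "\<lambda>b. if b then f else g" "\<lambda>b. if b then 1 else -1"] by simp

lemma hardy_inner_diff_left:
  assumes "f \<in> hardy2" "g \<in> hardy2" "h \<in> hardy2"
  shows "hardy_inner (\<lambda>z. f z - g z) h = hardy_inner f h - hardy_inner g h"
proof (rule has_sum_unique[OF hardy_inner_tendsto(2)])
  have "((\<lambda>k. coef f k * cnj (coef h k) + - (coef g k * cnj (coef h k))) has_sum hardy_inner f h +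
      - hardy_inner g h) UNIV"
    using hardy_inner_tendsto(2)[of f h] hardy_inner_tendsto(2)[of g h] assms
    by (intro has_sum_add) (simp_all add: has_sum_uminus)
  thus "((\<lambda>k. coef (\<lambda>z. f z - g z) k * cnj (coef h k)) has_sum hardy_inner f h - hardy_inner g h) UNIV"
    using assms by (simp add: coef_diff hardy2_analytic0 algebra_simps)
qed (use assms in \<open>auto intro: hardy2_diff\<close>)

lemma hardy_inner_diff_right:
  assumes "f \<in> hardy2" "g \<in> hardy2" "h \<in> hardy2"
  shows "hardy_inner h (\<lambda>z. f z - g z) = hardy_inner h f - hardy_inner h g"
  using assms by (simp add: hardy_inner_commute[of _ h] hardy2_diff hardy_inner_diff_left)

lemma hardy_inner_sum_right:
  assumes J: "finite J" and f: "\<And>j. j \<in> J \<Longrightarrow> f j \<in> hardy2" and g: "g \<in> hardy2"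
  shows "hardy_inner g (\<lambda>z. \<Sum>j\<in>J. c j * f j z) = (\<Sum>j\<in>J. cnj (c j) * hardy_inner g (f j))"
proof (rule has_sum_unique[OF hardy_inner_tendsto(2)[OF g hardy2_sum[OF J f]]])
  have "((\<lambda>k. \<Sum>j\<in>J. cnj (c j) * (coef g k * cnj (coef (f j) k)))
      has_sum (\<Sum>j\<in>J. cnj (c j) * hardy_inner g (f j))) UNIV"
    using J f g by (intro has_sum_finite_combination hardy_inner_tendsto) auto
  also have "(\<lambda>k. \<Sum>j\<in>J. cnj (c j) * (coef g k * cnj (coef (f j) k))) =
      (\<lambda>k. coef g k * cnj (coef (\<lambda>z. \<Sum>j\<in>J. c j * f j z) k))"
    using J f by (simp add: coef_sum hardy2_analytic0 sum_distrib_left mult.left_commute)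
  finally show "((\<lambda>k. coef g k * cnj (coef (\<lambda>z. \<Sum>j\<in>J. c j * f j z) k)) has_sum
      (\<Sum>j\<in>J. cnj (c j) * hardy_inner g (f j))) UNIV" .
qed auto

lemma hardy_Cauchy_Schwarz:
  fixes f g :: "complex ^ 'n \<Rightarrow> complex"
  assumes f: "f \<in> hardy2" and g: "g \<in> hardy2"
  shows "norm (hardy_inner f g) \<le> hardy_norm f * hardy_norm g"
proof -
  have L2: "L2_set (\<lambda>k. norm (coef h k)) F \<le> hardy_norm h" if "h \<in> hardy2" "finite F"
      for h :: "complex ^ 'n \<Rightarrow> complex" and F
  proof -
    have "(\<Sum>k\<in>F. (norm (coef h k))\<^sup>2) \<le> (hardy_norm h)\<^sup>2"
      using that by (intro finite_sum_le_has_sum[OF hardy_norm_has_sum]) auto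
    thus ?thesis unfolding L2_set_def using hardy_norm_nonneg[OF that(1)]
        by (simp add: real_le_lsqrt sum_nonneg)
  qed
  have "norm (hardy_inner f g) \<le> (\<Sum>\<^sub>\<infinity>k. norm (coef f k * cnj (coef g k)))"
    using has_sum_infsum[OF hardy_inner_tendsto(3)[OF f g]] hardy_inner_tendsto(2)[OF f g]
    by (rule norm_has_sum_bound)
  also have "\<dots> \<le> hardy_norm f * hardy_norm g"
  proof (rule infsum_le_finite_sums[OF hardy_inner_tendsto(3)[OF f g]])
    fix F :: "('n \<Rightarrow> nat) set" assume F: "finite F"
    have "(\<Sum>k\<in>F. norm (coef f k * cnj (coef g k))) \<le> L2_set (\<lambda>k. norm (coef f k)) F
        * L2_set (\<lambda>k. norm (coef g k)) F"
      using L2_set_mult_ineq[of "\<lambda>k. norm (coef f k)" "\<lambda>k. norm (coef g k)" F] by (simp add: norm_mult)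
    also have "\<dots> \<le> hardy_norm f * hardy_norm g"
      using F f g by (intro mult_mono L2 hardy_norm_nonneg) (auto simp: L2_set_nonneg)
    finally show "(\<Sum>k\<in>F. norm (coef f k * cnj (coef g k))) \<le> hardy_norm f * hardy_norm g" .
  qed
  finally show ?thesis .
qed

lemma hardy2_eqI:
  fixes f g :: "complex ^ 'n \<Rightarrow> complex"
  assumes "f \<in> hardy2" "g \<in> hardy2" "hardy_norm (\<lambda>z. f z - g z) = 0"
  shows "f = g"
proof (rule analytic0_eqI)
  show "coef f = coef g"
  proof
    fix k :: "'n \<Rightarrow> nat"
    have "(norm (coef (\<lambda>z. f z - g z) k))\<^sup>2 = 0"
      using nonneg_has_sum_le_0D[OF hardy_norm_has_sum[OF hardy2_diff[OF assms(1,2)]], of k] assms(3)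
          by simp
    thus "coef f k = coef g k" using assms by (simp add: coef_diff hardy2_analytic0)
  qed
qed (use assms in \<open>auto intro: hardy2_analytic0\<close>)

lemma square_integrable_scaled:
  fixes f :: "complex ^ 'n \<Rightarrow> complex"
  assumes f: "f \<in> analytic0" and r: "0 \<le> r" "r < 1"
  shows "integrable torus_measure (\<lambda>z. (norm (f (r *\<^sub>R z)))\<^sup>2)"
proof -
  interpret prob_space "torus_measure :: (complex ^ 'n) measure" by (rule prob_space_torus_measure)
  note f[THEN analytic0_measurable, measurable]
  obtain B where B: "0 \<le> B" "\<And>z. (\<And>i. norm (z $ i) \<le> 1) \<Longrightarrow> norm (f (r *\<^sub>R z)) \<le> B"
    using analytic0_bounded[OF f r] by blast
  show ?thesis
  proof (rule integrable_const_bound)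
    show "AE z in torus_measure. norm ((norm (f (r *\<^sub>R z)))\<^sup>2) \<le> B\<^sup>2"
      using AE_torus_measure by eventually_elim (auto intro!: power_mono B)
  qed measurable
qed

text \<open>On each torus of radius less than 1 the factor is bounded by \<open>C\<close>, so no boundary values are involved.\<close>

lemma hardy_mult:
  fixes \<phi> :: "complex ^ 'n \<Rightarrow> complex"
  assumes \<phi>: "\<phi> \<in> H_infinity" and f: "f \<in> hardy2"
  shows hardy2_mult: "(\<lambda>z. \<phi> z * f z) \<in> hardy2"
    and hardy_norm_mult_le: "(\<And>z. z \<in> polydisc \<Longrightarrow> norm (\<phi> z) \<le> C) \<Longrightarrow> hardy_norm (\<lambda>z. \<phi> z * f z) \<le> C
        * hardy_norm f"
proof -
  note f0 = hardy2_analytic0[OF f]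
  have bdd: "bdd_above (square_mean f ` {0..<1})" using f by (simp add: hardy2_def)
  have g0: "(\<lambda>z. \<phi> z * f z) \<in> analytic0" by (rule analytic0_mult[OF \<phi> f0])
  have le: "square_mean (\<lambda>z. \<phi> z * f z) r \<le> (C * hardy_norm f)\<^sup>2"
    if C: "\<And>z. z \<in> polydisc \<Longrightarrow> norm (\<phi> z) \<le> C" and r: "0 \<le> r" "r < 1" for C r
  proof -
    have "square_mean (\<lambda>z. \<phi> z * f z) r \<le> (LINT z|torus_measure. C\<^sup>2 * (norm (f (r *\<^sub>R z)))\<^sup>2)"
      unfolding square_mean_def
    proof (rule integral_mono_AE[OF square_integrable_scaled[OF g0 r]])
      show "AE z in torus_measure. (norm (\<phi> (r *\<^sub>R z) * f (r *\<^sub>R z)))\<^sup>2 \<le> C\<^sup>2 * (norm (f (r *\<^sub>R z)))\<^sup>2"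
        using AE_torus_measure
      proof eventually_elim
        case (elim z)
        hence "r *\<^sub>R z \<in> polydisc" using r by (intro scaleR_in_polydisc) auto
        thus ?case unfolding norm_mult power_mult_distrib by (intro mult_right_mono power_mono C) auto
      qed
    qed (intro integrable_mult_right square_integrable_scaled[OF f0 r])
    also have "\<dots> = C\<^sup>2 * square_mean f r" by (simp add: square_mean_def)
    also have "square_mean f r \<le> (hardy_norm f)\<^sup>2"
    proof -
      have "square_mean f r \<le> (SUP r\<in>{0..<1}. square_mean f r)" using r by (intro cSUP_upper bdd) auto
      thus ?thesis unfolding hardy_norm_def using hardy_norm_nonneg[OF f, unfolded hardy_norm_def] by simp
    qed
    finally show ?thesis by (simp add: power_mult_distrib mult_left_mono)
  qed
  obtain B where B: "\<And>z. z \<in> polydisc \<Longrightarrow> norm (\<phi> z) \<le> B"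
    using \<phi> by (auto simp: H_infinity_def bounded_iff)
  show g: "(\<lambda>z. \<phi> z * f z) \<in> hardy2"
  proof -
    have "square_mean (\<lambda>z. \<phi> z * f z) r \<le> (B * hardy_norm f)\<^sup>2" if "r \<in> {0..<1}" for r
      using le[of B r] B that by auto
    hence "bdd_above (square_mean (\<lambda>z. \<phi> z * f z) ` {0..<1})" by (rule bdd_aboveI2)
    thus ?thesis using g0 by (simp add: hardy2_def analytic0_def)
  qed
  assume C: "\<And>z. z \<in> polydisc \<Longrightarrow> norm (\<phi> z) \<le> C"
  have "0 \<in> (polydisc :: (complex ^ 'n) set)" by (simp add: polydisc_def)
  hence "0 \<le> C" using C norm_ge_zero order_trans by blast
  thus "hardy_norm (\<lambda>z. \<phi> z * f z) \<le> C * hardy_norm f"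
    using hardy_norm_nonneg[OF f] by (intro hardy_norm_le[OF g] le C) auto
qed

section \<open>Adjoints of multiplication operators\<close>

lemma hardy2_power_series:
  fixes a :: "('n::finite \<Rightarrow> nat) \<Rightarrow> complex"
  assumes a: "(\<lambda>k. (norm (a k))\<^sup>2) summable_on UNIV"
  shows "power_series a \<in> hardy2" "coef (power_series a) = a"
proof -
  have bound: "norm (a k) \<le> sqrt (\<Sum>\<^sub>\<infinity>k. (norm (a k))\<^sup>2)" for k
  proof (rule real_le_rsqrt)
    show "(norm (a k))\<^sup>2 \<le> (\<Sum>\<^sub>\<infinity>k. (norm (a k))\<^sup>2)"
      using finite_sum_le_infsum[OF a, of "{k}"] by simp
  qed
  from bound show c: "coef (power_series a) = a" by (rule coef_power_series)
  from bound have "power_series a \<in> analytic0" by (rule power_series_analytic0)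
  with a show "power_series a \<in> hardy2" by (simp add: hardy2_iff c)
qed

text \<open>The monomials, cut off outside the polydisc: the orthonormal basis of the Hardy space.\<close>

definition zmon :: "('n \<Rightarrow> nat) \<Rightarrow> complex ^ 'n \<Rightarrow> complex" where
  "zmon k = power_series (\<lambda>l. if l = k then 1 else 0)"

lemma zmon: 
  fixes k :: "'n::finite \<Rightarrow> nat"
  shows zmon_hardy2: "zmon k \<in> hardy2" and coef_zmon: "coef (zmon k) = (\<lambda>l. if l = k then 1 else 0)"
proof -
  have "((\<lambda>l. (norm (if l = k then 1 else 0 :: complex))\<^sup>2) has_sum 1) UNIV"
    by (rule has_sum_finite_neutralI[of "{k}"]) auto
  from hardy2_power_series[OF has_sum_imp_summable[OF this]]
  show "zmon k \<in> hardy2" "coef (zmon k) = (\<lambda>l. if l = k then 1 else 0)"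
    by (simp_all add: zmon_def)
qed

lemma zmon_eq_zpow:
  assumes "z \<in> polydisc"
  shows "zmon k z = zpow k z"
proof -
  have "((\<lambda>l. (if l = k then 1 else 0) * zpow l z) has_sum zpow k z) UNIV"
    by (rule has_sum_finite_neutralI[of "{k}"]) auto
  thus ?thesis using assms by (simp add: zmon_def power_series_def infsumI)
qed

lemma hardy_inner_zmon:
  fixes f :: "complex ^ 'n \<Rightarrow> complex"
  assumes f: "f \<in> hardy2"
  shows "hardy_inner f (zmon k) = coef f k" "hardy_inner (zmon k) f = cnj (coef f k)"
proof -
  have "((\<lambda>l. coef f l * cnj (coef (zmon k) l)) has_sum coef f k) UNIV"
    by (rule has_sum_finite_neutralI[of "{k}"]) (auto simp: coef_zmon)
  with hardy_inner_tendsto(2)[OF f zmon_hardy2] show 1: "hardy_inner f (zmon k) = coef f k"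
    by (rule has_sum_unique)
  show "hardy_inner (zmon k) f = cnj (coef f k)"
    using hardy_inner_commute[OF f zmon_hardy2, of k] 1 by simp
qed

text \<open>The adjoint of multiplication by \<open>\<phi>\<close>: its coefficients are the inner products that the
adjoint relation prescribes on monomials.\<close>

definition mult_adjoint :: "(complex ^ 'n \<Rightarrow> complex) \<Rightarrow> (complex ^ 'n \<Rightarrow> complex) \<Rightarrow> complex ^ 'n \<Rightarrow>
    complex" where
  "mult_adjoint \<phi> f = power_series (\<lambda>k. hardy_inner f (\<lambda>z. \<phi> z * zmon k z))"

lemma H_infinity_bound:
  assumes "\<phi> \<in> H_infinity"
  obtains C where "0 \<le> C" "\<And>z. z \<in> polydisc \<Longrightarrow> norm (\<phi> z) \<le> C"
  using assms unfolding H_infinity_def bounded_pos by (auto intro: less_imp_le)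

lemma norm_hardy_inner_mult_le:
  assumes \<phi>: "\<phi> \<in> H_infinity" and C: "\<And>z. z \<in> polydisc \<Longrightarrow> norm (\<phi> z) \<le> C"
    and f: "f \<in> hardy2" and u: "u \<in> hardy2"
  shows "norm (hardy_inner f (\<lambda>z. \<phi> z * u z)) \<le> hardy_norm f * C * hardy_norm u"
proof -
  have "norm (hardy_inner f (\<lambda>z. \<phi> z * u z)) \<le> hardy_norm f * hardy_norm (\<lambda>z. \<phi> z * u z)"
    using f hardy2_mult[OF \<phi> u] by (rule hardy_Cauchy_Schwarz)
  also have "\<dots> \<le> hardy_norm f * (C * hardy_norm u)"
    using hardy_norm_mult_le[OF \<phi> u C] hardy_norm_nonneg[OF f] by (intro mult_left_mono)
  finally show ?thesis by simp
qed

lemma hardy_inner_mult_combination: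
  assumes \<phi>: "\<phi> \<in> H_infinity" and f: "f \<in> hardy2" and F: "finite F"
  shows "hardy_inner f (\<lambda>z. \<phi> z * (\<Sum>k\<in>F. c k * zmon k z))
      = (\<Sum>k\<in>F. cnj (c k) * hardy_inner f (\<lambda>z. \<phi> z * zmon k z))"
proof -
  have "(\<lambda>z. \<phi> z * (\<Sum>k\<in>F. c k * zmon k z)) = (\<lambda>z. \<Sum>k\<in>F. c k * (\<phi> z * zmon k z))"
    by (simp add: sum_distrib_left mult.left_commute)
  thus ?thesis
    using hardy_inner_sum_right[OF F hardy2_mult[OF \<phi> zmon_hardy2] f, of c] by simp
qed

text \<open>Bessel's argument: for a finite set \<open>F\<close> of indices let $u = \sum_{k \in F} c_k z^k$, where the
$c_k$ are the numbers in question, and let $S$ be the sum of the $|c_k|^2$ over \<open>F\<close>. Then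
$S = \langle f, \varphi u \rangle \le K \|u\| = K \sqrt S$, so $S \le K^2$.\<close>

lemma mult_adjoint_summable:
  fixes \<phi> :: "complex ^ 'n \<Rightarrow> complex"
  assumes \<phi>: "\<phi> \<in> H_infinity" and f: "f \<in> hardy2"
  shows "(\<lambda>k. (norm (hardy_inner f (\<lambda>z. \<phi> z * zmon k z)))\<^sup>2) summable_on UNIV"
proof -
  obtain C where C: "0 \<le> C" "\<And>z. z \<in> polydisc \<Longrightarrow> norm (\<phi> z) \<le> C"
    using H_infinity_bound[OF \<phi>] by blast
  define c where "c = (\<lambda>k. hardy_inner f (\<lambda>z. \<phi> z * zmon k z))"
  define K where "K = hardy_norm f * C"
  have K: "0 \<le> K" using C hardy_norm_nonneg[OF f] by (simp add: K_def)
  have "(\<Sum>k\<in>F. (norm (c k))\<^sup>2) \<le> K\<^sup>2" if F: "finite F" for F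
  proof -
    define u where "u = (\<lambda>z. \<Sum>k\<in>F. c k * zmon k z)"
    define S where "S = (\<Sum>k\<in>F. (norm (c k))\<^sup>2)"
    have S: "0 \<le> S" unfolding S_def by (intro sum_nonneg) auto
    have u: "u \<in> hardy2" unfolding u_def by (rule hardy2_sum[OF F zmon_hardy2])
    have coef_u: "coef u l = (if l \<in> F then c l else 0)" for l
      unfolding u_def using F by (simp add: coef_sum hardy2_analytic0[OF zmon_hardy2] coef_zmon
          if_distrib sum.delta' cong: if_cong)
    have "((\<lambda>k. (norm (coef u k))\<^sup>2) has_sum S) UNIV"
      using F unfolding S_def by (intro has_sum_finite_neutralI[of F]) (auto simp: coef_u)
    with hardy_norm_has_sum[OF u] have Su: "(hardy_norm u)\<^sup>2 = S" by (rule has_sum_unique)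
    have "hardy_inner f (\<lambda>z. \<phi> z * u z) = (\<Sum>k\<in>F. cnj (c k) * c k)"
      unfolding u_def c_def by (rule hardy_inner_mult_combination[OF \<phi> f F])
    also have "\<dots> = of_real S"
      unfolding S_def of_real_sum complex_norm_square by (simp add: mult.commute)
    finally have "S \<le> K * hardy_norm u"
      using norm_hardy_inner_mult_le[OF \<phi> C(2) f u] S by (simp add: K_def)
    hence "S\<^sup>2 \<le> (K * hardy_norm u)\<^sup>2" using S by (intro power_mono)
    hence "S * S \<le> K\<^sup>2 * S" by (simp only: power_mult_distrib Su power2_eq_square[of S])
    thus ?thesis unfolding S_def[symmetric] using S K
      by (cases "S = 0") (auto simp: mult_le_cancel_right)
  qed
  thus ?thesis unfolding c_def
    by (intro nonneg_bdd_above_summable_on) (auto intro!: bdd_aboveI)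
qed

lemma mult_adjoint_hardy2: "\<phi> \<in> H_infinity \<Longrightarrow> f \<in> hardy2 \<Longrightarrow> mult_adjoint \<phi> f \<in> hardy2"
  and coef_mult_adjoint: "\<phi> \<in> H_infinity \<Longrightarrow> f \<in> hardy2 \<Longrightarrow> coef (mult_adjoint \<phi> f) k
      = hardy_inner f (\<lambda>z. \<phi> z * zmon k z)"
  unfolding mult_adjoint_def
  by (rule hardy2_power_series(1)[OF mult_adjoint_summable])
      (simp_all add: hardy2_power_series(2)[OF mult_adjoint_summable])

text \<open>For polynomials this holds by construction. The partial sums of the series of \<open>u\<close> tend to \<open>u\<close> in
norm, and both sides are continuous in \<open>u\<close>.\<close>

lemma hardy_inner_mult_adjoint:
  fixes \<phi> :: "complex ^ 'n \<Rightarrow> complex"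
  assumes \<phi>: "\<phi> \<in> H_infinity" and f: "f \<in> hardy2" and u: "u \<in> hardy2"
  shows "hardy_inner f (\<lambda>z. \<phi> z * u z) = hardy_inner (mult_adjoint \<phi> f) u"
proof -
  obtain C where C: "0 \<le> C" "\<And>z. z \<in> polydisc \<Longrightarrow> norm (\<phi> z) \<le> C"
    using H_infinity_bound[OF \<phi>] by blast
  define p where "p = (\<lambda>F z. \<Sum>k\<in>F. coef u k * zmon k z)"
  have p: "p F \<in> hardy2" if "finite F" for F
    unfolding p_def by (rule hardy2_sum[OF that zmon_hardy2])
  let ?c = "\<lambda>k. coef (mult_adjoint \<phi> f) k * cnj (coef u k)"
  have partial: "hardy_inner f (\<lambda>z. \<phi> z * p F z) = sum ?c F" if "finite F" for F
    unfolding p_def hardy_inner_mult_combination[OF \<phi> f that] coef_mult_adjoint[OF \<phi> f]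
        by (simp add: mult.commute)
  have bound: "norm (sum ?c F - hardy_inner f (\<lambda>z. \<phi> z * u z)) \<le>
      hardy_norm f * C * sqrt ((hardy_norm u)\<^sup>2 - (\<Sum>k\<in>F. (norm (coef u k))\<^sup>2))" if F: "finite F" for F
  proof -
    let ?d = "\<lambda>z. p F z - u z"
    have d: "?d \<in> hardy2" using p[OF F] u by (rule hardy2_diff)
    have coef_p: "coef (p F) l = (if l \<in> F then coef u l else 0)" for l
      unfolding p_def using F by (simp add: coef_sum hardy2_analytic0[OF zmon_hardy2] coef_zmon
          if_distrib sum.delta' cong: if_cong)
    have coef_d: "coef ?d l = (if l \<in> F then 0 else - coef u l)" for l
      using coef_diff[OF hardy2_analytic0[OF p[OF F]] hardy2_analytic0[OF u], of l] by (simp add: coef_p)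
    have "((\<lambda>k. (norm (coef u k))\<^sup>2) has_sum ((hardy_norm u)\<^sup>2 - (\<Sum>k\<in>F. (norm (coef u k))\<^sup>2))) (UNIV - F)"
      using hardy_norm_has_sum[OF u] F by (intro has_sum_Diff) auto
    also have "?this \<longleftrightarrow> ((\<lambda>k. (norm (coef ?d k))\<^sup>2)
        has_sum ((hardy_norm u)\<^sup>2 - (\<Sum>k\<in>F. (norm (coef u k))\<^sup>2))) UNIV"
      by (rule has_sum_cong_neutral) (auto simp: coef_d)
    finally have "(hardy_norm ?d)\<^sup>2 = (hardy_norm u)\<^sup>2 - (\<Sum>k\<in>F. (norm (coef u k))\<^sup>2)"
      using hardy_norm_has_sum[OF d] has_sum_unique by blast
    hence nd: "hardy_norm ?d = sqrt ((hardy_norm u)\<^sup>2 - (\<Sum>k\<in>F. (norm (coef u k))\<^sup>2))"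
      using hardy_norm_nonneg[OF d] by (simp add: real_sqrt_unique)
    have "sum ?c F - hardy_inner f (\<lambda>z. \<phi> z * u z) = hardy_inner f (\<lambda>z. \<phi> z * p F z - \<phi> z * u z)"
      using hardy_inner_diff_right[OF hardy2_mult[OF \<phi> p[OF F]] hardy2_mult[OF \<phi> u] f] partial[OF F] by simp
    also have "\<dots> = hardy_inner f (\<lambda>z. \<phi> z * ?d z)" by (simp add: right_diff_distrib)
    also have "norm \<dots> \<le> hardy_norm f * C * hardy_norm ?d"
      by (rule norm_hardy_inner_mult_le[OF \<phi> C(2) f d])
    finally show ?thesis unfolding nd .
  qed
  have "((\<lambda>F. hardy_norm f * C * sqrt ((hardy_norm u)\<^sup>2 - (\<Sum>k\<in>F. (norm (coef u k))\<^sup>2))) \<longlongrightarrow>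
      hardy_norm f * C * sqrt ((hardy_norm u)\<^sup>2 - (hardy_norm u)\<^sup>2)) (finite_subsets_at_top UNIV)"
    using hardy_norm_has_sum[OF u] unfolding has_sum_def by (intro tendsto_intros)
  hence lim0: "((\<lambda>F. hardy_norm f * C * sqrt ((hardy_norm u)\<^sup>2 - (\<Sum>k\<in>F. (norm (coef u k))\<^sup>2))) \<longlongrightarrow> 0)
      (finite_subsets_at_top UNIV)" by (simp only: diff_self real_sqrt_zero mult_zero_right)
  have "\<forall>\<^sub>F F in finite_subsets_at_top UNIV. norm (sum ?c F - hardy_inner f (\<lambda>z. \<phi> z * u z)) \<le>
      hardy_norm f * C * sqrt ((hardy_norm u)\<^sup>2 - (\<Sum>k\<in>F. (norm (coef u k))\<^sup>2))"
    by (rule eventually_finite_subsets_at_top_weakI) (rule bound)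
  hence "((\<lambda>F. sum ?c F - hardy_inner f (\<lambda>z. \<phi> z * u z)) \<longlongrightarrow> 0) (finite_subsets_at_top UNIV)"
    using lim0 by (rule Lim_null_comparison)
  hence "(?c has_sum hardy_inner f (\<lambda>z. \<phi> z * u z)) UNIV"
    unfolding has_sum_def by (simp add: LIM_zero_iff)
  thus ?thesis
    using hardy_inner_tendsto(2)[OF mult_adjoint_hardy2[OF \<phi> f] u] by (rule has_sum_unique)
qed

section \<open>Inner functions and model spaces\<close>

lemma inner_function_H_infinity: "inner_function \<phi> \<Longrightarrow> \<phi> \<in> H_infinity"
  by (simp add: inner_function_def)

text \<open>Since $|\varphi|^2$ tends to 1 radially almost everywhere, dominated convergence turns the inner
product into that of the monomials themselves. The argument works for monomials because they are
continuous up to the torus.\<close>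

lemma inner_mult_zmon:
  fixes \<phi> :: "complex ^ 'n \<Rightarrow> complex"
  assumes \<phi>: "inner_function \<phi>"
  shows "hardy_inner (\<lambda>z. \<phi> z * zmon k z) (\<lambda>z. \<phi> z * zmon l z) = (if k = l then 1 else 0)"
proof -
  interpret prob_space "torus_measure :: (complex ^ 'n) measure" by (rule prob_space_torus_measure)
  note \<phi>0 = inner_function_H_infinity[OF \<phi>]
  let ?f = "\<lambda>k z. \<phi> z * zmon k z"
  have f: "?f k \<in> hardy2" for k by (rule hardy2_mult[OF \<phi>0 zmon_hardy2])
  note [measurable] = f[THEN hardy2_analytic0, THEN analytic0_measurable]
  obtain C where C: "0 \<le> C" "\<And>z. z \<in> polydisc \<Longrightarrow> norm (\<phi> z) \<le> C"
    using H_infinity_bound[OF \<phi>0] by blast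
  \<comment> \<open>Dominated convergence is about sequences, so the radii run through one that tends to 1 from below.\<close>
  define r where "r = (\<lambda>n. 1 - 1 / real (n + 2))"
  have r: "0 \<le> r n" "r n < 1" for n by (auto simp: r_def field_simps)
  have "r \<longlonglongrightarrow> 1" unfolding r_def by real_asymp
  hence rlim: "filterlim r (at_left 1) sequentially"
    using r less_imp_neq[OF r(2)] by (auto simp: filterlim_at intro!: always_eventually)
  let ?I = "\<lambda>n z. ?f k (r n *\<^sub>R z) * cnj (?f l (r n *\<^sub>R z))"
  have lim1: "(\<lambda>n. LINT z|torus_measure. ?I n z) \<longlonglongrightarrow> hardy_inner (?f k) (?f l)"
    by (rule filterlim_compose[OF hardy_inner_tendsto(1)[OF f f] rlim])
  have I_eq: "?I n z = \<phi> (r n *\<^sub>R z) * cnj (\<phi> (r n *\<^sub>R z))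
      * (of_real (r n) ^ (tdeg k + tdeg l) * (zpow k z * cnj (zpow l z)))"
    if "\<And>i. norm (z $ i) = 1" for n z
  proof -
    have "r n *\<^sub>R z \<in> polydisc" using r that by (intro scaleR_in_polydisc) auto
    thus ?thesis by (simp add: zmon_eq_zpow zpow_scaleR power_add mult_ac)
  qed
  have "(\<lambda>n. LINT z|torus_measure. ?I n z) \<longlonglongrightarrow> (LINT z|torus_measure. zpow k z * cnj (zpow l z))"
  proof (rule integral_dominated_convergence[where w = "\<lambda>_. C * C"])
    show "AE z in torus_measure. (\<lambda>n. ?I n z) \<longlonglongrightarrow> zpow k z * cnj (zpow l z)"
    proof -
      have "AE z in torus_measure. \<exists>w. ((\<lambda>r::real. \<phi> (r *\<^sub>R z)) \<longlongrightarrow> w) (at_left 1) \<and> norm w = 1"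
        using \<phi> by (simp add: inner_function_def)
      with AE_torus_measure show ?thesis
      proof eventually_elim
        case (elim z)
        then obtain w where w: "((\<lambda>r::real. \<phi> (r *\<^sub>R z)) \<longlongrightarrow> w) (at_left 1)" "norm w = 1" by blast
        have \<phi>lim: "(\<lambda>n. \<phi> (r n *\<^sub>R z)) \<longlonglongrightarrow> w" by (rule filterlim_compose[OF w(1) rlim])
        have "w * cnj w = 1" using w(2) by (simp flip: complex_norm_square)
        have "(\<lambda>n. \<phi> (r n *\<^sub>R z) * cnj (\<phi> (r n *\<^sub>R z))
            * (of_real (r n) ^ (tdeg k + tdeg l) * (zpow k z * cnj (zpow l z))))
            \<longlonglongrightarrow> w * cnj w * (of_real 1 ^ (tdeg k + tdeg l) * (zpow k z * cnj (zpow l z)))"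
          by (intro tendsto_intros \<phi>lim \<open>r \<longlonglongrightarrow> 1\<close>)
        moreover have "(\<lambda>n. ?I n z) = (\<lambda>n. \<phi> (r n *\<^sub>R z) * cnj (\<phi> (r n *\<^sub>R z)) *
            (of_real (r n) ^ (tdeg k + tdeg l) * (zpow k z * cnj (zpow l z))))"
          using elim by (intro ext I_eq) auto
        ultimately show ?case by (simp only: \<open>w * cnj w = 1\<close> of_real_1 power_one mult_1_left)
      qed
    qed
    show "AE z in torus_measure. norm (?I n z) \<le> C * C" for n
      using AE_torus_measure
    proof eventually_elim
      case (elim z)
      hence D: "r n *\<^sub>R z \<in> polydisc" using r by (intro scaleR_in_polydisc) auto
      have "norm (zpow j (r n *\<^sub>R z)) \<le> 1" for j :: "'n \<Rightarrow> nat"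
        using norm_zpow_le[of "r n *\<^sub>R z" 1 j] D by (simp add: polydisc_def less_imp_le)
      hence "norm (?f j (r n *\<^sub>R z)) \<le> C * 1" for j
        unfolding norm_mult zmon_eq_zpow[OF D] using C D by (intro mult_mono) auto
      hence "norm (?f k (r n *\<^sub>R z)) * norm (?f l (r n *\<^sub>R z)) \<le> C * C"
        using C(1) by (intro mult_mono) (auto simp del: norm_mult)
      thus ?case by (simp add: norm_mult)
    qed
    show "integrable torus_measure (\<lambda>_ :: complex ^ 'n. C * C)" by (rule integrable_const)
  qed measurable
  with lim1 show ?thesis unfolding zpow_orthonormal by (rule LIMSEQ_unique)
qed

text \<open>By \<open>inner_mult_zmon\<close> the adjoint of multiplication by \<open>\<phi>\<close> maps \<open>\<phi>\<close> times a monomial back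
to the monomial. Taking inner products with a general \<open>f\<close>, this shows that it maps \<open>\<phi> f\<close>
back to \<open>f\<close>, which is the claim.\<close>

lemma inner_mult_isometry:
  fixes \<phi> :: "complex ^ 'n \<Rightarrow> complex"
  assumes \<phi>: "inner_function \<phi>" and f: "f \<in> hardy2" and g: "g \<in> hardy2"
  shows "hardy_inner (\<lambda>z. \<phi> z * f z) (\<lambda>z. \<phi> z * g z) = hardy_inner f g"
proof -
  note \<phi>0 = inner_function_H_infinity[OF \<phi>]
  note mult = hardy2_mult[OF \<phi>0]
  have 1: "mult_adjoint \<phi> (\<lambda>z. \<phi> z * zmon k z) = zmon k" for k
    by (rule analytic0_eqI)
       (auto simp: fun_eq_iff coef_mult_adjoint \<phi>0 mult zmon_hardy2 coef_zmon inner_mult_zmon[OF \<phi>]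
           intro!: hardy2_analytic0 mult_adjoint_hardy2)
  have 2: "hardy_inner (\<lambda>z. \<phi> z * zmon k z) (\<lambda>z. \<phi> z * f z) = cnj (coef f k)" for k
    using hardy_inner_mult_adjoint[OF \<phi>0 mult[OF zmon_hardy2] f] by (simp add: 1 hardy_inner_zmon[OF f])
  have "mult_adjoint \<phi> (\<lambda>z. \<phi> z * f z) = f"
  proof (rule analytic0_eqI)
    show "coef (mult_adjoint \<phi> (\<lambda>z. \<phi> z * f z)) = coef f"
    proof
      fix k
      show "coef (mult_adjoint \<phi> (\<lambda>z. \<phi> z * f z)) k = coef f k"
        using hardy_inner_commute[OF mult[OF zmon_hardy2] mult[OF f], of k]
        by (simp add: coef_mult_adjoint[OF \<phi>0 mult[OF f]] 2)
    qed
  qed (auto intro!: hardy2_analytic0 mult_adjoint_hardy2 \<phi>0 mult f)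
  thus ?thesis using hardy_inner_mult_adjoint[OF \<phi>0 mult[OF f] g] by simp
qed

lemma inner_mult_norm:
  assumes "inner_function \<phi>" "f \<in> hardy2"
  shows "hardy_norm (\<lambda>z. \<phi> z * f z) = hardy_norm f"
proof -
  note g = hardy2_mult[OF inner_function_H_infinity[OF assms(1)] assms(2)]
  have "complex_of_real ((hardy_norm (\<lambda>z. \<phi> z * f z))\<^sup>2) = of_real ((hardy_norm f)\<^sup>2)"
    using inner_mult_isometry[OF assms assms(2)]
        by (simp only: hardy_inner_self[OF g] hardy_inner_self[OF assms(2)])
  hence "(hardy_norm (\<lambda>z. \<phi> z * f z))\<^sup>2 = (hardy_norm f)\<^sup>2" by (simp only: of_real_eq_iff)
  thus ?thesis using hardy_norm_nonneg[OF g] hardy_norm_nonneg[OF assms(2)] by simp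
qed

lemma model_space_hardy2: "f \<in> model_space \<phi> \<Longrightarrow> f \<in> hardy2"
  by (simp add: model_space_def)

lemma model_space_orthogonal: "f \<in> model_space \<phi> \<Longrightarrow> h \<in> hardy2 \<Longrightarrow> hardy_inner f (\<lambda>z. \<phi> z * h z) = 0"
  by (simp add: model_space_def)

lemma model_space_diff:
  assumes "\<phi> \<in> H_infinity" "f \<in> model_space \<phi>" "g \<in> model_space \<phi>"
  shows "(\<lambda>z. f z - g z) \<in> model_space \<phi>"
  using assms by (auto simp: model_space_def hardy2_diff hardy_inner_diff_left hardy2_mult)

text \<open>The adjoint of an isometry is a left inverse of it, so subtracting $T_\varphi T_\varphi^* f$
removes the component of \<open>f\<close> in the range of $T_\varphi$.\<close>

lemma model_space_residual:
  assumes \<phi>: "inner_function \<phi>" and f: "f \<in> hardy2"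
  shows "(\<lambda>z. f z - \<phi> z * mult_adjoint \<phi> f z) \<in> model_space \<phi>"
proof -
  note \<phi>0 = inner_function_H_infinity[OF \<phi>]
  note a = mult_adjoint_hardy2[OF \<phi>0 f]
  note pa = hardy2_mult[OF \<phi>0 a]
  have "hardy_inner (\<lambda>z. f z - \<phi> z * mult_adjoint \<phi> f z) (\<lambda>z. \<phi> z * h z) = 0" if h: "h \<in> hardy2" for h
    using hardy_inner_diff_left[OF f pa hardy2_mult[OF \<phi>0 h]] hardy_inner_mult_adjoint[OF \<phi>0 f h]
      inner_mult_isometry[OF \<phi> a h] by simp
  thus ?thesis using hardy2_diff[OF f pa] by (simp add: model_space_def)
qed

text \<open>Both existence and uniqueness matter, because the projection is a definite description.\<close>

lemma hardy_proj_model_space: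
  fixes \<phi> :: "complex ^ 'n \<Rightarrow> complex"
  assumes \<phi>: "inner_function \<phi>" and f: "f \<in> hardy2"
  shows "hardy_proj (model_space \<phi>) f = (\<lambda>z. f z - \<phi> z * mult_adjoint \<phi> f z)" (is "_ = ?q")
proof -
  note \<phi>0 = inner_function_H_infinity[OF \<phi>]
  note a = mult_adjoint_hardy2[OF \<phi>0 f]
  have q: "?q \<in> model_space \<phi>" by (rule model_space_residual[OF \<phi> f])
  have orth: "hardy_inner (\<lambda>z. f z - ?q z) h = 0" if h: "h \<in> model_space \<phi>" for h
    using hardy_inner_commute[OF model_space_hardy2[OF h] hardy2_mult[OF \<phi>0 a]]
        model_space_orthogonal[OF h a] by simp
  show ?thesis
    unfolding hardy_proj_def
  proof (rule the_equality)
    fix g assume g: "g \<in> model_space \<phi> \<and> (\<forall>h\<in>model_space \<phi>. hardy_inner (\<lambda>z. f z - g z) h = 0)"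
    let ?d = "\<lambda>z. g z - ?q z"
    have d: "?d \<in> model_space \<phi>" using g by (intro model_space_diff[OF \<phi>0 _ q]) simp
    have "g \<in> hardy2" using g model_space_hardy2 by blast
    note H = model_space_hardy2[OF d] model_space_hardy2[OF q] this
    have "(\<lambda>z. (f z - ?q z) - (f z - g z)) = ?d" by (simp add: fun_eq_iff)
    hence "hardy_inner ?d ?d = hardy_inner (\<lambda>z. (f z - ?q z) - (f z - g z)) ?d" by (simp only:)
    also have "\<dots> = hardy_inner (\<lambda>z. f z - ?q z) ?d - hardy_inner (\<lambda>z. f z - g z) ?d"
      by (rule hardy_inner_diff_left[OF hardy2_diff[OF f H(2)] hardy2_diff[OF f H(3)] H(1)])
    also have "\<dots> = 0" using g d orth[OF d] by simp
    finally have "hardy_norm ?d = 0" by (simp add: hardy_inner_self[OF H(1)])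
    thus "g = ?q" by (rule hardy2_eqI[OF H(3,2)])
  qed (use q orth in auto)
qed

text \<open>The vector \<open>\<psi> f\<close> has the norm of \<open>f\<close>. By orthogonality its projection has the same norm only if
the component that the projection removes is 0.\<close>

lemma isometry_iff_invariant:
  fixes \<phi> \<psi> :: "complex ^ 'n \<Rightarrow> complex"
  assumes \<phi>: "inner_function \<phi>" and \<psi>: "inner_function \<psi>"
  shows "hardy_isometry_on (model_space \<phi>) (truncated_toeplitz \<phi> \<psi>) \<longleftrightarrow>
    (\<forall>f\<in>model_space \<phi>. (\<lambda>z. \<psi> z * f z) \<in> model_space \<phi>)"
proof -
  note \<phi>0 = inner_function_H_infinity[OF \<phi>] and \<psi>0 = inner_function_H_infinity[OF \<psi>]
  have "hardy_norm (truncated_toeplitz \<phi> \<psi> f) = hardy_norm f \<longleftrightarrow> (\<lambda>z. \<psi> z * f z) \<in> model_space \<phi>"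
    if f: "f \<in> model_space \<phi>" for f
  proof -
    define u where "u = (\<lambda>z. \<psi> z * f z)"
    define w where "w = mult_adjoint \<phi> u"
    define q where "q = (\<lambda>z. u z - \<phi> z * w z)"
    have u: "u \<in> hardy2" unfolding u_def using \<psi>0 model_space_hardy2[OF f] by (rule hardy2_mult)
    have w: "w \<in> hardy2" unfolding w_def by (rule mult_adjoint_hardy2[OF \<phi>0 u])
    have q: "q \<in> model_space \<phi>" unfolding q_def w_def by (rule model_space_residual[OF \<phi> u])
    note q2 = model_space_hardy2[OF q] and pw = hardy2_mult[OF \<phi>0 w]
    have T: "truncated_toeplitz \<phi> \<psi> f = q"
      unfolding truncated_toeplitz_def q_def w_def u_def[symmetric] by (rule hardy_proj_model_space[OF \<phi> u])
    have norm_u: "hardy_norm u = hardy_norm f"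
      unfolding u_def by (rule inner_mult_norm[OF \<psi> model_space_hardy2[OF f]])
    have uq: "(\<lambda>z. u z - q z) = (\<lambda>z. \<phi> z * w z)" by (simp add: q_def)
    show ?thesis
      unfolding T u_def[symmetric]
    proof
      assume "hardy_norm q = hardy_norm f"
      hence eq: "hardy_inner q q = hardy_inner u u" by (simp add: hardy_inner_self u q2 norm_u)
      have qw: "hardy_inner q (\<lambda>z. u z - q z) = 0" unfolding uq by (rule model_space_orthogonal[OF q w])
      hence "hardy_inner q u = hardy_inner q q" using hardy_inner_diff_right[OF u q2 q2] by simp
      hence "hardy_inner u q = hardy_inner q q"
        using hardy_inner_commute[OF q2 u] hardy_inner_commute[OF q2 q2] by simp
      hence "hardy_inner (\<lambda>z. u z - q z) (\<lambda>z. u z - q z) = 0"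
        using hardy_inner_diff_left[OF u q2 hardy2_diff[OF u q2]] hardy_inner_diff_right[OF u q2 u] qw
            eq by simp
      hence "hardy_norm (\<lambda>z. u z - q z) = 0" by (simp add: hardy_inner_self[OF hardy2_diff[OF u q2]])
      hence "u = q" by (intro hardy2_eqI u q2)
      thus "u \<in> model_space \<phi>" using q by simp
    next
      assume um: "u \<in> model_space \<phi>"
      have "hardy_inner (\<lambda>z. \<phi> z * w z) (\<lambda>z. \<phi> z * w z) = 0"
        using model_space_orthogonal[OF model_space_diff[OF \<phi>0 um q] w] by (simp add: uq)
      hence "hardy_norm (\<lambda>z. u z - q z) = 0" unfolding uq by (simp add: hardy_inner_self[OF pw])
      hence "u = q" by (intro hardy2_eqI u q2)
      thus "hardy_norm q = hardy_norm f" using norm_u by simp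
    qed
  qed
  thus ?thesis by (simp add: hardy_isometry_on_def)
qed

text \<open>The right side says that $T_\psi^* T_\varphi$ and $T_\varphi T_\psi^*$ have the same matrix. If the
model space is invariant, test this with the projections $z^\alpha - T_\varphi T_\varphi^* z^\alpha$ of the
monomials. If the operators commute, then $T_\psi^*$ maps the range of $T_\varphi$ into itself, so
$T_\psi$ maps the orthogonal complement of this range into itself.\<close>

lemma invariant_iff_commuting:
  fixes \<phi> \<psi> :: "complex ^ 'n \<Rightarrow> complex"
  assumes \<phi>: "inner_function \<phi>" and \<psi>: "inner_function \<psi>"
  shows "(\<forall>f\<in>model_space \<phi>. (\<lambda>z. \<psi> z * f z) \<in> model_space \<phi>) \<longleftrightarrow>
    (\<forall>\<alpha> \<beta>. hardy_inner (\<lambda>z. \<phi> z * zmon \<beta> z) (\<lambda>z. \<psi> z * zmon \<alpha> z) =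
      hardy_inner (mult_adjoint \<psi> (zmon \<beta>)) (mult_adjoint \<phi> (zmon \<alpha>)))"
proof
  note \<phi>0 = inner_function_H_infinity[OF \<phi>] and \<psi>0 = inner_function_H_infinity[OF \<psi>]
  note H = zmon_hardy2 hardy2_mult[OF \<phi>0] hardy2_mult[OF \<psi>0] mult_adjoint_hardy2[OF \<phi>0]
      mult_adjoint_hardy2[OF \<psi>0]
  {
    assume inv: "\<forall>f\<in>model_space \<phi>. (\<lambda>z. \<psi> z * f z) \<in> model_space \<phi>"
    show "\<forall>\<alpha> \<beta>. hardy_inner (\<lambda>z. \<phi> z * zmon \<beta> z) (\<lambda>z. \<psi> z * zmon \<alpha> z) =
      hardy_inner (mult_adjoint \<psi> (zmon \<beta>)) (mult_adjoint \<phi> (zmon \<alpha>))"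
    proof (intro allI)
      fix \<alpha> \<beta> :: "'n \<Rightarrow> nat"
      let ?w = "mult_adjoint \<phi> (zmon \<alpha>)"
      let ?e = "\<lambda>z. \<phi> z * zmon \<beta> z"
      have "(\<lambda>z. \<psi> z * (zmon \<alpha> z - \<phi> z * ?w z)) \<in> model_space \<phi>"
        using inv model_space_residual[OF \<phi> zmon_hardy2, of \<alpha>] by auto
      from model_space_orthogonal[OF this zmon_hardy2]
      have "hardy_inner ?e (\<lambda>z. \<psi> z * (zmon \<alpha> z - \<phi> z * ?w z)) = 0"
        using hardy_inner_commute[OF model_space_hardy2[OF \<open>(\<lambda>z. \<psi> z * (zmon \<alpha> z - \<phi> z * ?w z))
            \<in> model_space \<phi>\<close>] H(2)[OF zmon_hardy2, of \<beta>]]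
        by simp
      also have "(\<lambda>z. \<psi> z * (zmon \<alpha> z - \<phi> z * ?w z)) = (\<lambda>z. \<psi> z * zmon \<alpha> z - \<phi> z * (\<psi> z * ?w z))"
        by (simp add: algebra_simps)
      also have "hardy_inner ?e \<dots> = hardy_inner ?e (\<lambda>z. \<psi> z * zmon \<alpha> z)
          - hardy_inner ?e (\<lambda>z. \<phi> z * (\<psi> z * ?w z))"
        by (intro hardy_inner_diff_right H)
      also have "hardy_inner ?e (\<lambda>z. \<phi> z * (\<psi> z * ?w z)) = hardy_inner (zmon \<beta>) (\<lambda>z. \<psi> z * ?w z)"
        by (intro inner_mult_isometry \<phi> H)
      also have "\<dots> = hardy_inner (mult_adjoint \<psi> (zmon \<beta>)) ?w"
        by (intro hardy_inner_mult_adjoint \<psi>0 H)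
      finally show "hardy_inner ?e (\<lambda>z. \<psi> z * zmon \<alpha> z) = hardy_inner (mult_adjoint \<psi> (zmon \<beta>)) ?w"
        by simp
    qed
  next
    assume comm: "\<forall>\<alpha> \<beta>. hardy_inner (\<lambda>z. \<phi> z * zmon \<beta> z) (\<lambda>z. \<psi> z * zmon \<alpha> z) =
      hardy_inner (mult_adjoint \<psi> (zmon \<beta>)) (mult_adjoint \<phi> (zmon \<alpha>))"
    have v: "mult_adjoint \<psi> (\<lambda>z. \<phi> z * zmon \<beta> z) = (\<lambda>z. \<phi> z * mult_adjoint \<psi> (zmon \<beta>) z)" for \<beta>
    proof (rule analytic0_eqI)
      show "coef (mult_adjoint \<psi> (\<lambda>z. \<phi> z * zmon \<beta> z)) = coef (\<lambda>z. \<phi> z * mult_adjoint \<psi> (zmon \<beta>) z)"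
      proof
        fix \<alpha>
        let ?w = "mult_adjoint \<psi> (zmon \<beta>)"
        have "coef (mult_adjoint \<psi> (\<lambda>z. \<phi> z * zmon \<beta> z)) \<alpha> = hardy_inner ?w (mult_adjoint \<phi> (zmon \<alpha>))"
          using comm by (simp add: coef_mult_adjoint \<psi>0 H)
        also have "\<dots> = cnj (hardy_inner (zmon \<alpha>) (\<lambda>z. \<phi> z * ?w z))"
          using hardy_inner_commute[of "mult_adjoint \<phi> (zmon \<alpha>)" ?w]
              by (simp add: hardy_inner_mult_adjoint \<phi>0 H)
        also have "\<dots> = coef (\<lambda>z. \<phi> z * ?w z) \<alpha>" by (simp add: hardy_inner_zmon H)
        finally show "coef (mult_adjoint \<psi> (\<lambda>z. \<phi> z * zmon \<beta> z)) \<alpha> = coef (\<lambda>z. \<phi> z * ?w z) \<alpha>" .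
      qed
    qed (intro hardy2_analytic0 H)+
    show "\<forall>f\<in>model_space \<phi>. (\<lambda>z. \<psi> z * f z) \<in> model_space \<phi>"
    proof
      fix f assume f: "f \<in> model_space \<phi>"
      note f2 = model_space_hardy2[OF f]
      let ?u = "\<lambda>z. \<psi> z * f z"
      have "hardy_inner ?u (\<lambda>z. \<phi> z * zmon \<beta> z) = 0" for \<beta>
      proof -
        have "hardy_inner (\<lambda>z. \<phi> z * zmon \<beta> z) ?u = hardy_inner (\<lambda>z. \<phi> z * mult_adjoint \<psi> (zmon \<beta>) z) f"
          unfolding v[symmetric] by (intro hardy_inner_mult_adjoint \<psi>0 H f2)
        also have "\<dots> = cnj (hardy_inner f (\<lambda>z. \<phi> z * mult_adjoint \<psi> (zmon \<beta>) z))"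
          by (intro hardy_inner_commute H f2)
        also have "\<dots> = 0" using model_space_orthogonal[OF f H(5)[OF zmon_hardy2]] by simp
        finally show ?thesis using hardy_inner_commute[of "\<lambda>z. \<phi> z * zmon \<beta> z" ?u] by (simp add: H f2)
      qed
      hence "coef (mult_adjoint \<phi> ?u) = (\<lambda>_. 0)" by (auto simp: coef_mult_adjoint \<phi>0 H f2)
      hence "hardy_inner (mult_adjoint \<phi> ?u) h = 0" if "h \<in> hardy2" for h
        using has_sum_unique[OF hardy_inner_tendsto(2)[OF H(4)[OF H(3)[OF f2]] that]] by simp
      thus "?u \<in> model_space \<phi>"
        by (auto simp: model_space_def hardy_inner_mult_adjoint \<phi>0 H f2)
    qed
  }
qed

section \<open>The commutation relation in coefficients\<close>

lemma finite_multi_index_le: "finite {\<delta>. \<delta> \<le> (\<alpha> :: 'n::finite \<Rightarrow> nat)}"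
proof -
  have "{\<delta>. \<delta> \<le> \<alpha>} = PiE UNIV (\<lambda>i. {..\<alpha> i})" by (auto simp: le_fun_def)
  thus ?thesis by (simp add: finite_PiE)
qed

text \<open>The bijection $\gamma = \alpha + \beta - \delta$ covers exactly the $\gamma$ with
$\gamma \le \alpha + \beta$; if $\gamma_i > \alpha_i + \beta_i$, then $\gamma - \beta$ and
$\gamma - \alpha$ are both positive in the coordinate $i$ and the term vanishes.\<close>

lemma separated_imp_commuting:
  fixes a b :: "('n::finite \<Rightarrow> nat) \<Rightarrow> complex"
  assumes sep: "\<And>p q i. 0 < p i \<Longrightarrow> 0 < q i \<Longrightarrow> a p * cnj (b q) = 0"
  shows "((\<lambda>\<gamma>. a (\<gamma> - \<beta>) * cnj (b (\<gamma> - \<alpha>))) has_sum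
      (\<Sum>\<delta>\<in>{\<delta>. \<delta> \<le> \<alpha> \<and> \<delta> \<le> \<beta>}. a (\<alpha> - \<delta>) * cnj (b (\<beta> - \<delta>)))) {\<gamma>. \<alpha> \<le> \<gamma> \<and> \<beta> \<le> \<gamma>}"
proof (rule has_sum_finite_neutralI)
  let ?G = "{\<gamma>. \<alpha> \<le> \<gamma> \<and> \<beta> \<le> \<gamma> \<and> \<gamma> \<le> (\<lambda>i. \<alpha> i + \<beta> i)}"
  show "finite ?G" by (rule finite_subset[OF _ finite_multi_index_le]) auto
  show "?G \<subseteq> {\<gamma>. \<alpha> \<le> \<gamma> \<and> \<beta> \<le> \<gamma>}" by auto
  show "a (\<gamma> - \<beta>) * cnj (b (\<gamma> - \<alpha>)) = 0" if "\<gamma> \<in> {\<gamma>. \<alpha> \<le> \<gamma> \<and> \<beta> \<le> \<gamma>} - ?G" for \<gamma>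
  proof -
    have "\<not> \<gamma> \<le> (\<lambda>i. \<alpha> i + \<beta> i)" using that by blast
    then obtain i where "\<alpha> i + \<beta> i < \<gamma> i" by (auto simp: le_fun_def not_le)
    thus ?thesis by (intro sep[of _ i]) auto
  qed
  show "(\<Sum>\<delta>\<in>{\<delta>. \<delta> \<le> \<alpha> \<and> \<delta> \<le> \<beta>}. a (\<alpha> - \<delta>) * cnj (b (\<beta> - \<delta>))) =
      (\<Sum>\<gamma>\<in>?G. a (\<gamma> - \<beta>) * cnj (b (\<gamma> - \<alpha>)))"
  proof (rule sum.reindex_bij_witness[of _ "\<lambda>\<gamma> i. \<alpha> i + \<beta> i - \<gamma> i" "\<lambda>\<delta> i. \<alpha> i + \<beta> i - \<delta> i"])
    fix \<delta> assume "\<delta> \<in> {\<delta>. \<delta> \<le> \<alpha> \<and> \<delta> \<le> \<beta>}"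
    hence d: "\<delta> i \<le> \<alpha> i" "\<delta> i \<le> \<beta> i" for i by (auto simp: le_fun_def)
    let ?\<gamma> = "\<lambda>i. \<alpha> i + \<beta> i - \<delta> i"
    show "(\<lambda>i. \<alpha> i + \<beta> i - ?\<gamma> i) = \<delta>" using d
        by (auto simp: fun_eq_iff intro: diff_diff_cancel trans_le_add1)
    have "\<alpha> i \<le> ?\<gamma> i" "\<beta> i \<le> ?\<gamma> i" for i using d[of i] by linarith+
    thus "?\<gamma> \<in> ?G" by (simp add: le_fun_def)
    have "?\<gamma> - \<beta> = \<alpha> - \<delta>" "?\<gamma> - \<alpha> = \<beta> - \<delta>" using d by (auto simp: fun_eq_iff)
    thus "a (?\<gamma> - \<beta>) * cnj (b (?\<gamma> - \<alpha>)) = a (\<alpha> - \<delta>) * cnj (b (\<beta> - \<delta>))" by simp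
  next
    fix \<gamma> assume "\<gamma> \<in> ?G"
    hence g: "\<alpha> i \<le> \<gamma> i" "\<beta> i \<le> \<gamma> i" "\<gamma> i \<le> \<alpha> i + \<beta> i" for i by (auto simp: le_fun_def)
    show "(\<lambda>i. \<alpha> i + \<beta> i - (\<alpha> i + \<beta> i - \<gamma> i)) = \<gamma>" using g by (auto simp: fun_eq_iff)
    show "(\<lambda>i. \<alpha> i + \<beta> i - \<gamma> i) \<in> {\<delta>. \<delta> \<le> \<alpha> \<and> \<delta> \<le> \<beta>}"
      using g by (auto simp: le_fun_def le_diff_conv add.commute)
  qed
qed

text \<open>Decreasing $p_i$ and $q_i$ by one leaves the infinite sum unchanged and removes from the finite sum
exactly the terms with $\delta_i = 0$. So these terms add up to 0. Those with $\delta \ne 0$ vanish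
individually by induction, as $p - \delta$ has smaller degree and keeps its coordinate $i$; what is
left is the term $\delta = 0$, which is the claim.\<close>

lemma commuting_imp_separated:
  fixes a b :: "('n::finite \<Rightarrow> nat) \<Rightarrow> complex"
  assumes comm: "\<And>\<alpha> \<beta>. ((\<lambda>\<gamma>. a (\<gamma> - \<beta>) * cnj (b (\<gamma> - \<alpha>))) has_sum
      (\<Sum>\<delta>\<in>{\<delta>. \<delta> \<le> \<alpha> \<and> \<delta> \<le> \<beta>}. a (\<alpha> - \<delta>) * cnj (b (\<beta> - \<delta>)))) {\<gamma>. \<alpha> \<le> \<gamma> \<and> \<beta> \<le> \<gamma>}"
  shows "0 < p i \<Longrightarrow> 0 < q i \<Longrightarrow> a p * cnj (b q) = 0"
proof (induction "tdeg p" arbitrary: p q rule: less_induct)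
  case less
  note p = less.prems(1) and q = less.prems(2)
  let ?up = "\<lambda>\<gamma>. \<gamma>(i := Suc (\<gamma> i))" and ?down = "\<lambda>\<gamma>. \<gamma>(i := \<gamma> i - 1)"
  let ?t = "\<lambda>p q \<delta>. a (p - \<delta>) * cnj (b (q - \<delta>))"
  let ?D = "{\<delta>. \<delta> \<le> p \<and> \<delta> \<le> q}" and ?D' = "{\<delta>. \<delta> \<le> ?down p \<and> \<delta> \<le> ?down q}"
  have fin: "finite ?D" by (rule finite_subset[OF _ finite_multi_index_le[of p]]) auto
  have "((\<lambda>\<gamma>. a (\<gamma> - ?down q) * cnj (b (\<gamma> - ?down p))) has_sum sum (?t p q) ?D) {\<gamma>. ?down p
      \<le> \<gamma> \<and> ?down q \<le> \<gamma>}
    \<longleftrightarrow> ((\<lambda>\<gamma>. a (\<gamma> - q) * cnj (b (\<gamma> - p))) has_sum sum (?t p q) ?D) {\<gamma>. p \<le> \<gamma> \<and> q \<le> \<gamma>}"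
  proof (rule has_sum_reindex_bij_witness[of _ ?down ?up])
    fix \<gamma> assume "\<gamma> \<in> {\<gamma>. ?down p \<le> \<gamma> \<and> ?down q \<le> \<gamma>}"
    hence g: "?down p j \<le> \<gamma> j" "?down q j \<le> \<gamma> j" for j by (simp_all only: mem_Collect_eq le_fun_def)
    show "?down (?up \<gamma>) = \<gamma>" by auto
    have "p j \<le> ?up \<gamma> j" "q j \<le> ?up \<gamma> j" for j using g[of j] by (auto split: if_splits)
    thus "?up \<gamma> \<in> {\<gamma>. p \<le> \<gamma> \<and> q \<le> \<gamma>}" by (simp add: le_fun_def)
    have "?up \<gamma> - q = \<gamma> - ?down q" "?up \<gamma> - p = \<gamma> - ?down p" using p q by (auto simp: fun_eq_iff)
    thus "a (?up \<gamma> - q) * cnj (b (?up \<gamma> - p)) = a (\<gamma> - ?down q) * cnj (b (\<gamma> - ?down p))" by (simp only:)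
  next
    fix \<gamma> assume "\<gamma> \<in> {\<gamma>. p \<le> \<gamma> \<and> q \<le> \<gamma>}"
    hence g: "p j \<le> \<gamma> j" "q j \<le> \<gamma> j" for j by (simp_all add: le_fun_def)
    have "0 < \<gamma> i" using p g[of i] by simp
    thus "?up (?down \<gamma>) = \<gamma>" by auto
    show "?down \<gamma> \<in> {\<gamma>. ?down p \<le> \<gamma> \<and> ?down q \<le> \<gamma>}" using g by (auto simp: le_fun_def intro: diff_le_mono)
  qed simp
  with comm[of q p] comm[of "?down q" "?down p"]
  have eq: "sum (?t p q) ?D = sum (?t (?down p) (?down q)) ?D'"
    by (intro has_sum_unique) auto
  have "sum (?t (?down p) (?down q)) ?D' = sum (?t p q) {\<delta>\<in>?D. 0 < \<delta> i}"
  proof (rule sum.reindex_bij_witness[of _ ?down ?up])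
    fix \<delta> assume "\<delta> \<in> ?D'"
    hence g: "\<delta> j \<le> ?down p j" "\<delta> j \<le> ?down q j" for j by (simp_all only: mem_Collect_eq le_fun_def)
    show "?down (?up \<delta>) = \<delta>" by auto
    have "?up \<delta> j \<le> p j" "?up \<delta> j \<le> q j" for j using g[of j] p q by (auto split: if_splits)
    thus "?up \<delta> \<in> {\<delta>\<in>?D. 0 < \<delta> i}" by (simp add: le_fun_def)
    have "p - ?up \<delta> = ?down p - \<delta>" "q - ?up \<delta> = ?down q - \<delta>" by (auto simp: fun_eq_iff)
    thus "?t p q (?up \<delta>) = ?t (?down p) (?down q) \<delta>" by (simp only:)
  next
    fix \<delta> assume "\<delta> \<in> {\<delta>\<in>?D. 0 < \<delta> i}"
    hence g: "\<delta> j \<le> p j" "\<delta> j \<le> q j" "0 < \<delta> i" for j by (simp_all add: le_fun_def)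
    show "?up (?down \<delta>) = \<delta>" using g by auto
    show "?down \<delta> \<in> ?D'" using g by (auto simp: le_fun_def intro: diff_le_mono)
  qed
  moreover have "sum (?t p q) ?D = sum (?t p q) {\<delta>\<in>?D. 0 < \<delta> i} + sum (?t p q) {\<delta>\<in>?D. \<delta> i = 0}"
    using fin by (subst sum.union_disjoint[symmetric])
        (auto intro!: sum.cong intro: finite_subset[OF _ fin])
  ultimately have "sum (?t p q) {\<delta>\<in>?D. \<delta> i = 0} = 0" using eq by simp
  also have "sum (?t p q) {\<delta>\<in>?D. \<delta> i = 0} = sum (?t p q) {\<lambda>_. 0}"
  proof (rule sum.mono_neutral_right)
    show "\<forall>\<delta>\<in>{\<delta>\<in>?D. \<delta> i = 0} - {\<lambda>_. 0}. ?t p q \<delta> = 0"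
    proof
      fix \<delta> assume d: "\<delta> \<in> {\<delta>\<in>?D. \<delta> i = 0} - {\<lambda>_. 0}"
      then obtain j where j: "0 < \<delta> j" by (auto simp: fun_eq_iff)
      have "\<delta> j \<le> p j" using d by (simp add: le_fun_def)
      with j have "tdeg (p - \<delta>) < tdeg p"
        unfolding tdeg_def by (intro sum_strict_mono_ex1 bexI[of _ j]) auto
      thus "?t p q \<delta> = 0" using d p q by (intro less.hyps) auto
    qed
    show "finite {\<delta>\<in>?D. \<delta> i = 0}" by (rule finite_subset[OF _ fin]) auto
  qed (auto simp: le_fun_def)
  finally show ?case by (simp add: fun_diff_def)
qed

section \<open>Coefficients of bounded functions and separatedness\<close>

text \<open>A function in \<^const>\<open>H_infinity\<close> is arbitrary off the polydisc; cutting it off makes its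
coefficients accessible to the integral in \<^const>\<open>coef\<close>.\<close>

definition polydisc_part :: "(complex ^ 'n \<Rightarrow> complex) \<Rightarrow> complex ^ 'n \<Rightarrow> complex" where
  "polydisc_part \<phi> z = (if z \<in> polydisc then \<phi> z else 0)"

lemma polydisc_part_analytic0:
  assumes "\<phi> \<in> H_infinity"
  shows "polydisc_part \<phi> \<in> analytic0"
proof -
  have "polydisc_part \<phi> = (\<lambda>z. \<phi> z * zmon (\<lambda>_. 0) z)"
    by (auto simp: fun_eq_iff polydisc_part_def zmon_eq_zpow zpow_def) (simp add: zmon_def power_series_def)
  thus ?thesis using hardy2_mult[OF assms zmon_hardy2] by (simp add: hardy2_analytic0)
qed

lemma Taylor_polydisc_part:
  assumes "\<phi> \<in> H_infinity" "z \<in> polydisc"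
  shows "((\<lambda>k. coef (polydisc_part \<phi>) k * zpow k z) has_sum \<phi> z) UNIV"
  using Taylor_polydisc[OF polydisc_part_analytic0] assms by (fastforce simp: polydisc_part_def)

lemma coef_mult_zmon:
  fixes \<phi> :: "complex ^ 'n \<Rightarrow> complex"
  assumes \<phi>: "\<phi> \<in> H_infinity"
  shows "coef (\<lambda>z. \<phi> z * zmon k z) = (\<lambda>l. if k \<le> l then coef (polydisc_part \<phi>) (l - k) else 0)"
proof (rule coef_unique[OF hardy2_analytic0[OF hardy2_mult[OF \<phi> zmon_hardy2]]])
  fix z :: "complex ^ 'n" assume z: "z \<in> polydisc"
  let ?a = "coef (polydisc_part \<phi>)"
  have zpow_add: "zpow (\<lambda>i. m i + k i) z = zpow m z * zpow k z" for m
    by (simp add: zpow_def power_add prod.distrib)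
  have "((\<lambda>m. ?a m * zpow m z * zpow k z) has_sum \<phi> z * zpow k z) UNIV"
    by (rule has_sum_cmult_left[OF Taylor_polydisc_part[OF \<phi> z]])
  also have "?this \<longleftrightarrow> ((\<lambda>l. ?a (l - k) * zpow l z) has_sum \<phi> z * zpow k z) {l. k \<le> l}"
    by (rule has_sum_reindex_bij_witness[of _ "\<lambda>l. l - k" "\<lambda>m i. m i + k i"])
       (auto simp: fun_eq_iff le_fun_def zpow_add fun_diff_def)
  also have "\<dots> \<longleftrightarrow> ((\<lambda>l. (if k \<le> l then ?a (l - k) else 0) * zpow l z) has_sum \<phi> z * zpow k z) UNIV"
    by (rule has_sum_cong_neutral) auto
  finally show "((\<lambda>l. (if k \<le> l then ?a (l - k) else 0) * zpow l z) has_sum \<phi> z * zmon k z) UNIV"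
    using z by (simp add: zmon_eq_zpow)
qed

lemma commuting_iff_separated:
  fixes \<phi> \<psi> :: "complex ^ 'n \<Rightarrow> complex"
  assumes \<phi>: "\<phi> \<in> H_infinity" and \<psi>: "\<psi> \<in> H_infinity"
  shows "(\<forall>\<alpha> \<beta>. hardy_inner (\<lambda>z. \<phi> z * zmon \<beta> z) (\<lambda>z. \<psi> z * zmon \<alpha> z) =
      hardy_inner (mult_adjoint \<psi> (zmon \<beta>)) (mult_adjoint \<phi> (zmon \<alpha>))) \<longleftrightarrow>
    (\<forall>p q i. 0 < p i \<longrightarrow> 0 < q i \<longrightarrow> coef (polydisc_part \<phi>) p * cnj (coef (polydisc_part \<psi>) q) = 0)"
proof -
  let ?a = "coef (polydisc_part \<phi>)" and ?b = "coef (polydisc_part \<psi>)"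
  note H = zmon_hardy2 hardy2_mult[OF \<phi>] hardy2_mult[OF \<psi>] mult_adjoint_hardy2[OF \<phi>]
      mult_adjoint_hardy2[OF \<psi>]
  have lhs: "((\<lambda>\<gamma>. ?a (\<gamma> - \<beta>) * cnj (?b (\<gamma> - \<alpha>))) has_sum
      hardy_inner (\<lambda>z. \<phi> z * zmon \<beta> z) (\<lambda>z. \<psi> z * zmon \<alpha> z)) {\<gamma>. \<alpha> \<le> \<gamma> \<and> \<beta> \<le> \<gamma>}" for \<alpha> \<beta>
  proof -
    have "((\<lambda>\<gamma>. coef (\<lambda>z. \<phi> z * zmon \<beta> z) \<gamma> * cnj (coef (\<lambda>z. \<psi> z * zmon \<alpha> z) \<gamma>)) has_sum
      hardy_inner (\<lambda>z. \<phi> z * zmon \<beta> z) (\<lambda>z. \<psi> z * zmon \<alpha> z)) UNIV"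
      by (intro hardy_inner_tendsto H)
    thus ?thesis
      by (rule has_sum_cong_neutral[THEN iffD1, rotated -1]) (auto simp: coef_mult_zmon \<phi> \<psi>)
  qed
  have coef_mult_adjoint_zmon: "coef (mult_adjoint \<phi> (zmon \<alpha>)) \<delta>
      = (if \<delta> \<le> \<alpha> then cnj (coef (polydisc_part \<phi>) (\<alpha> - \<delta>)) else 0)"
    if "\<phi> \<in> H_infinity" for \<phi> :: "complex ^ 'n \<Rightarrow> complex" and \<alpha> \<delta>
    using that by (simp add: coef_mult_adjoint zmon_hardy2 hardy_inner_zmon hardy2_mult coef_mult_zmon)
  have rhs: "hardy_inner (mult_adjoint \<psi> (zmon \<beta>)) (mult_adjoint \<phi> (zmon \<alpha>)) =
      (\<Sum>\<delta>\<in>{\<delta>. \<delta> \<le> \<alpha> \<and> \<delta> \<le> \<beta>}. ?a (\<alpha> - \<delta>) * cnj (?b (\<beta> - \<delta>)))" for \<alpha> \<beta>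
  proof (rule has_sum_unique[OF hardy_inner_tendsto(2)])
    show "((\<lambda>\<delta>. coef (mult_adjoint \<psi> (zmon \<beta>)) \<delta> * cnj (coef (mult_adjoint \<phi> (zmon \<alpha>)) \<delta>)) has_sum
      (\<Sum>\<delta>\<in>{\<delta>. \<delta> \<le> \<alpha> \<and> \<delta> \<le> \<beta>}. ?a (\<alpha> - \<delta>) * cnj (?b (\<beta> - \<delta>)))) UNIV"
      by (rule has_sum_finite_neutralI[of "{\<delta>. \<delta> \<le> \<alpha> \<and> \<delta> \<le> \<beta>}"])
         (auto simp: coef_mult_adjoint_zmon \<phi> \<psi> mult.commute intro!: sum.cong intro:
             finite_subset[OF _ finite_multi_index_le[of \<alpha>]])
  qed (intro H)+
  show ?thesis
  proof
    assume "\<forall>\<alpha> \<beta>. hardy_inner (\<lambda>z. \<phi> z * zmon \<beta> z) (\<lambda>z. \<psi> z * zmon \<alpha> z)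
        = hardy_inner (mult_adjoint \<psi> (zmon \<beta>)) (mult_adjoint \<phi> (zmon \<alpha>))"
    hence "((\<lambda>\<gamma>. ?a (\<gamma> - \<beta>) * cnj (?b (\<gamma> - \<alpha>))) has_sum
        (\<Sum>\<delta>\<in>{\<delta>. \<delta> \<le> \<alpha> \<and> \<delta> \<le> \<beta>}. ?a (\<alpha> - \<delta>) * cnj (?b (\<beta> - \<delta>)))) {\<gamma>. \<alpha> \<le> \<gamma> \<and> \<beta> \<le> \<gamma>}" for \<alpha> \<beta>
      using lhs[of \<beta> \<alpha>] rhs[of \<beta> \<alpha>] by simp
    from commuting_imp_separated[of ?a ?b, OF this]
    show "\<forall>p q i. 0 < p i \<longrightarrow> 0 < q i \<longrightarrow> ?a p * cnj (?b q) = 0" by blast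
  next
    assume "\<forall>p q i. 0 < p i \<longrightarrow> 0 < q i \<longrightarrow> ?a p * cnj (?b q) = 0"
    hence sep: "\<And>p q i. 0 < p i \<Longrightarrow> 0 < q i \<Longrightarrow> ?a p * cnj (?b q) = 0" by blast
    show "\<forall>\<alpha> \<beta>. hardy_inner (\<lambda>z. \<phi> z * zmon \<beta> z) (\<lambda>z. \<psi> z * zmon \<alpha> z)
        = hardy_inner (mult_adjoint \<psi> (zmon \<beta>)) (mult_adjoint \<phi> (zmon \<alpha>))"
      unfolding rhs by (intro allI has_sum_unique[OF lhs] separated_imp_commuting) (rule sep)
  qed
qed

text \<open>If \<open>\<phi>\<close> does not depend on $z_i$, then setting $z_i = 0$ in its expansion does not change its
values, and uniqueness of the coefficients kills those with $p_i > 0$.\<close>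

lemma depends_on_iff_coef:
  fixes \<phi> :: "complex ^ 'n \<Rightarrow> complex"
  assumes \<phi>: "\<phi> \<in> H_infinity"
  shows "depends_on \<phi> i \<longleftrightarrow> (\<exists>p. 0 < p i \<and> coef (polydisc_part \<phi>) p \<noteq> 0)"
proof
  let ?a = "coef (polydisc_part \<phi>)"
  assume "depends_on \<phi> i"
  then obtain z w where zw: "z \<in> polydisc" "w \<in> polydisc" "\<And>j. j \<noteq> i \<Longrightarrow> z $ j = w $ j" "\<phi> z \<noteq> \<phi> w"
    by (auto simp: depends_on_def)
  show "\<exists>p. 0 < p i \<and> ?a p \<noteq> 0"
  proof (rule ccontr)
    assume "\<not> (\<exists>p. 0 < p i \<and> ?a p \<noteq> 0)"
    hence a: "?a p = 0" if "0 < p i" for p using that by blast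
    have eq: "?a p * zpow p z = ?a p * zpow p w" for p
    proof (cases "p i = 0")
      case True
      hence "(z $ j) ^ p j = (w $ j) ^ p j" for j using zw(3)[of j] by (cases "j = i") auto
      thus ?thesis by (simp add: zpow_def)
    qed (simp add: a)
    thus False
      using Taylor_polydisc_part[OF \<phi> zw(1)] Taylor_polydisc_part[OF \<phi> zw(2)] zw(4)
      unfolding eq by (blast dest: has_sum_unique)
  qed
next
  let ?a = "coef (polydisc_part \<phi>)"
  assume "\<exists>p. 0 < p i \<and> ?a p \<noteq> 0"
  then obtain p where p: "0 < p i" "?a p \<noteq> 0" by blast
  show "depends_on \<phi> i"
  proof (rule ccontr)
    assume nd: "\<not> depends_on \<phi> i"
    have "?a = (\<lambda>k. if k i = 0 then ?a k else 0)"
    proof (rule coef_unique[OF polydisc_part_analytic0[OF \<phi>]])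
      fix z :: "complex ^ 'n" assume z: "z \<in> polydisc"
      define w :: "complex ^ 'n" where "w = (\<chi> j. if j = i then 0 else z $ j)"
      have w: "w \<in> polydisc" using z by (auto simp: w_def polydisc_def)
      have "\<forall>j. j \<noteq> i \<longrightarrow> w $ j = z $ j" by (simp add: w_def)
      hence eq: "\<phi> w = \<phi> z" using nd z w unfolding depends_on_def by blast
      have "?a k * zpow k w = (if k i = 0 then ?a k else 0) * zpow k z" for k
      proof (cases "k i = 0")
        case True
        hence "(w $ j) ^ k j = (z $ j) ^ k j" for j by (simp add: w_def)
        thus ?thesis using True by (simp add: zpow_def)
      next
        case False
        hence "zpow k w = 0" unfolding zpow_def by (intro prod_zero bexI[of _ i]) (auto simp: w_def)
        thus ?thesis using False by simp
      qed
      thus "((\<lambda>k. (if k i = 0 then ?a k else 0) * zpow k z) has_sum polydisc_part \<phi> z) UNIV"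
        using Taylor_polydisc_part[OF \<phi> w] z eq by (simp add: polydisc_part_def)
    qed
    from fun_cong[OF this, of p] p show False by simp
  qed
qed

theorem theorem4p6:
  fixes \<phi>1 \<phi>2 :: "complex ^ 'n \<Rightarrow> complex"
  assumes "CARD('n) > 1"
    and "inner_function \<phi>1" and "\<not> \<phi>1 constant_on polydisc"
    and "inner_function \<phi>2" and "\<not> \<phi>2 constant_on polydisc"
  shows "hardy_isometry_on (model_space \<phi>1) (truncated_toeplitz \<phi>1 \<phi>2) \<longleftrightarrow> separated \<phi>1 \<phi>2"
proof -
  have H: "\<phi>1 \<in> H_infinity" "\<phi>2 \<in> H_infinity"
    using assms by (auto intro: inner_function_H_infinity)
  have "hardy_isometry_on (model_space \<phi>1) (truncated_toeplitz \<phi>1 \<phi>2) \<longleftrightarrow>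
      (\<forall>p q i. 0 < p i \<longrightarrow> 0 < q i \<longrightarrow>
        coef (polydisc_part \<phi>1) p * cnj (coef (polydisc_part \<phi>2) q) = 0)"
    using assms by (simp only: isometry_iff_invariant invariant_iff_commuting commuting_iff_separated[OF H])
  also have "\<dots> \<longleftrightarrow> separated \<phi>1 \<phi>2"
    unfolding separated_def depends_on_iff_coef[OF H(1)] depends_on_iff_coef[OF H(2)] mult_eq_0_iff
        complex_cnj_zero_iff
    by blast
  finally show ?thesis .
qed

end
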